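(* Consider the following instance and algorithm. Let $n\in\{4,6,8,\dots\}$, $m=1$, and $E=\{(i,i+1)\}_{i=1}^{n-1}\cup\{(i,n+1)\}_{i=1}^{n}$: the honest agents $1,\dots,n$ form a line and the single malicious agent $n+1$ is adjacent to every honest agent. There are $K=n$ arms with deterministic rewards ($\nu_k=\delta_{\mu_k}$), where $$\mu_1=1,\qquad \mu_k=\tfrac{13}{15}+\sum_{h=1}^{(n/2)-k}2^{-2^{h+1}}\ \ (2\le k\le n/2),\qquad \mu_k=0\ \ (k>n/2).$$ The honest agents run the multi-agent algorithm with the existing blocking rule, with $\alpha=4$, $\beta=2$, $\eta=2$, sticky sets of size $S=1$, and for every $i\in\{1+n/2,\dots,n\}$ the initial active set satisfies $\min S_1^{(i)}>n/2$. The malicious agent uses the following strategy: let $J_1=2^8$ and $J_{l+1}=(J_l+2)^2$ for $l\in\mathbb N$; if $j=J_l$ and $i\in\{l+1+n/2,\ l+2+n/2\}$ for some $l\in\{1,\dots,(n/2)-1\}$, it recommends $R_j^{(i)}=1-l+n/2$; otherwise it recommends some $R_j^{(i)}\in S_j^{(i)}$ such that $B_{j+1}^{(i)}=R_j^{(i)}$ (such an arm exists since rewards are deterministic and, when the recommendation is already active, $S_{j+1}^{(i)}=S_j^{(i)}$, so $B_{j+1}^{(i)}$ is a deterministic function of the information available at time $A_j$). Then there is an absolute constant $c>0$ such that for every such $n$ and every horizon $T\ge 2$, $$R_T^{(n)}\ \ge\ c\,\min\Big\{\log T+\exp\big(\exp(n/3)\big),\ \frac{T}{\log^7 T}\Bi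g\}.$$
   Context: Setting. $G=([n+m],E)$ is an undirected graph; agents $1,\dots,n$ are honest and $n+1,\dots,n+m$ malicious; $N(i)$ denotes the neighbors of $i$. There are $K$ arms; arm $k$ has reward distribution $\nu_k$ with mean $\mu_k$, and honest agent $i$ pulling arm $k$ at time $t$ receives $X_{i,t}(k)\sim\nu_k$, independent over $i,t,k$. Arms are labeled so that $\mu_1\ge\cdots\ge\mu_K$, and $\Delta_k=\mu_1-\mu_k$. The regret of honest agent $i$ is $R_T^{(i)}=\sum_{t=1}^T\mathbb E[\mu_1-\mu_{I_t^{(i)}}]$, where $I_t^{(i)}$ is the arm it pulls at time $t$. Algorithm (run by each honest $i$). Parameters $\alpha>0,\beta>1,\eta>1$, integer $S\le K-2$, sticky set $\hat S^{(i)}\subset[K]$ with $|\hat S^{(i)}|=S$. Let $A_0=0$, $A_j=\lceil j^\beta\rceil$; phase $j$ is the times $A_{j-1}+1,\dots,A_j$. In phase $j$ agent $i$ has active set $S_j^{(i)}=\hat S^{(i)}\cup\{U_j^{(i)},L_j^{(i)}\}$ with $U_j^{(i)}\neq L_j^{(i)}$ non-sticky arms; $S_1^{(i)}$ is an arbitrary such set. Let $T_k^{(i)}(t)$ be the number of pulls of $k$ by $i$ up to time $t$ and $\hat\mu_k^{(i)}(t)$ their empirical mean. At each time $t$ in phase $j$, $i$ pulls $I_t^{(i)}\in\arg\max_{k\in S_j^{(i)}}\big(\hat\mu_k^{(i)}(t-1)+\sqrt{\alpha\log t/T_k^{(i)}(t-1)}\big)$ (index $+\infty$ if $T_k^{(i)}(t-1)=0$;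 ties broken by a fixed deterministic rule). At $t=A_j$: (1) $B_j^{(i)}\in\arg\max_{k\in S_j^{(i)}}(T_k^{(i)}(A_j)-T_k^{(i)}(A_{j-1}))$ (most played active arm in the phase); (2) the blocklists $P_{j'}^{(i)}\subset[n+m]$ ($j'\ge j$; initially all empty) are updated by the blocking rule; (3) $H_j^{(i)}$ is drawn uniformly at random from $N(i)\setminus P_j^{(i)}$; if $H_j^{(i)}\le n$ then $R_j^{(i)}=B_j^{(H_j^{(i)})}$, otherwise $R_j^{(i)}\in[K]$ is chosen by the malicious agent; (4) if $R_j^{(i)}\notin S_j^{(i)}$, set $U_{j+1}^{(i)}\in\arg\max_{k\in\{U_j^{(i)},L_j^{(i)}\}}(T_k^{(i)}(A_j)-T_k^{(i)}(A_{j-1}))$, $L_{j+1}^{(i)}=R_j^{(i)}$, $S_{j+1}^{(i)}=\hat S^{(i)}\cup\{U_{j+1}^{(i)},L_{j+1}^{(i)}\}$; otherwise $S_{j+1}^{(i)}=S_j^{(i)}$. Existing blocking rule: at phase $j>1$, if $B_j^{(i)}\neq R_{j-1}^{(i)}$, then $H_{j-1}^{(i)}$ is added to $P_{j'}^{(i)}$ for all $j'\in\{j,\dots,\lceil j^\eta\rceil\}$. *)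

theory Defs
  imports "HOL-Probability.Probability"
begin

definition Eset :: "nat \<Rightarrow> (nat \<times> nat) set" where
  "Eset n = {(i, i+1) | i. 1 \<le> i \<and> i \<le> n - 1} \<union> {(i, n+1) | i. 1 \<le> i \<and> i \<le> n}"

definition nbrs :: "nat \<Rightarrow> nat \<Rightarrow> nat set" where
  "nbrs n i = {h \<in> {1..n+1}. (i, h) \<in> Eset n \<or> (h, i) \<in> Eset n}"

definition mu :: "nat \<Rightarrow> nat \<Rightarrow> real" where
  "mu n k = (if k = 1 then 1
             else if 2 \<le> k \<and> k \<le> n div 2
               then 13/15 + (\<Sum>h=1..(n div 2) - k. (1/2::real) ^ (2 ^ (h+1)))
             else 0)"

fun Jseq :: "nat \<Rightarrow> nat" where
  "Jseq 0 = 0"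
| "Jseq (Suc 0) = 2^8"
| "Jseq (Suc (Suc l)) = (Jseq (Suc l) + 2)^2"

record agst =
  stk :: nat                      (* the sticky arm (S = 1) *)
  uu :: nat
  ll :: nat
  cnt :: "nat \<Rightarrow> nat"
  rsm :: "nat \<Rightarrow> real"
  pcnt :: "nat \<Rightarrow> nat"           (* T_k(A_{j-1}) *)
  blk :: "nat \<Rightarrow> nat"            (* h \<in> P_j iff j \<le> blk h *)
  prv :: "(nat \<times> nat) option"    (* (H_{j-1}, R_{j-1}) if a recommendation was received *)

definition active :: "agst \<Rightarrow> nat set" where
  "active a = {stk a, uu a, ll a}"

definition argmax_set :: "nat set \<Rightarrow> (nat \<Rightarrow> real) \<Rightarrow> nat set" where
  "argmax_set S f = {k \<in> S. \<forall>k' \<in> S. f k' \<le> f k}"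

(* set of maximisers of the UCB index (alpha = 4); arms with T_k = 0 have index +infinity *)
definition ucb_set :: "nat \<Rightarrow> agst \<Rightarrow> nat set" where
  "ucb_set t a = (let S = active a in
     if \<exists>k \<in> S. cnt a k = 0 then {k \<in> S. cnt a k = 0}
     else argmax_set S (\<lambda>k. rsm a k / real (cnt a k) + sqrt (4 * ln (real t) / real (cnt a k))))"

definition pick :: "(nat set \<Rightarrow> nat) \<Rightarrow> nat \<Rightarrow> agst \<Rightarrow> nat" where
  "pick tbI t a = tbI (ucb_set t a)"

definition lstep :: "nat \<Rightarrow> (nat set \<Rightarrow> nat) \<Rightarrow> nat \<Rightarrow> agst \<Rightarrow> agst" where
  "lstep n tbI t a = (let k = pick tbI t a in
     a\<lparr>cnt := (cnt a)(k := cnt a k + 1), rsm := (rsm a)(k := rsm a k + mu n k)\<rparr>)"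

(* state after k further steps, starting right after time t0 *)
fun upto :: "nat \<Rightarrow> (nat set \<Rightarrow> nat) \<Rightarrow> agst \<Rightarrow> nat \<Rightarrow> nat \<Rightarrow> agst" where
  "upto n tbI a t0 0 = a"
| "upto n tbI a t0 (Suc k) = lstep n tbI (t0 + Suc k) (upto n tbI a t0 k)"

(* beta = 2: A_j = j^2; phase j = times (j-1)^2+1 .. j^2 *)
definition run_phase :: "nat \<Rightarrow> (nat set \<Rightarrow> nat) \<Rightarrow> nat \<Rightarrow> agst \<Rightarrow> agst" where
  "run_phase n tbI j a = upto n tbI a ((j-1)^2) (j^2 - (j-1)^2)"

definition most_played :: "(nat set \<Rightarrow> nat) \<Rightarrow> agst \<Rightarrow> nat" where
  "most_played tbB a = tbB (argmax_set (active a) (\<lambda>k. real (cnt a k - pcnt a k)))"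

(* malicious recommendation to honest agent i at the end of phase j; a = i's state at A_j *)
definition mal_rec :: "nat \<Rightarrow> (nat set \<Rightarrow> nat) \<Rightarrow> (nat set \<Rightarrow> nat) \<Rightarrow> nat \<Rightarrow> nat \<Rightarrow> agst \<Rightarrow> nat" where
  "mal_rec n tbI tbB j i a =
     (let Ls = {l \<in> {1..n div 2 - 1}. j = Jseq l \<and> (i = l + 1 + n div 2 \<or> i = l + 2 + n div 2)} in
      if Ls \<noteq> {} then n div 2 + 1 - Min Ls
      else most_played tbB (run_phase n tbI (Suc j) (a\<lparr>pcnt := cnt a\<rparr>)))"

definition trans :: "nat \<Rightarrow> (nat set \<Rightarrow> nat) \<Rightarrow> (nat set \<Rightarrow> nat) \<Rightarrow> (nat set \<Rightarrow> nat) \<Rightarrow> nat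
                      \<Rightarrow> (nat \<Rightarrow> agst) \<Rightarrow> (nat \<Rightarrow> agst) pmf" where
  "trans n tbI tbB tbU j \<sigma> =
    (let E = (\<lambda>i. run_phase n tbI j (\<sigma> i));
         B = (\<lambda>i. most_played tbB (E i));
         E2 = (\<lambda>i. case prv (E i) of
                     None \<Rightarrow> E i
                   | Some (h, r) \<Rightarrow> (if 1 < j \<and> B i \<noteq> r
                        then E i\<lparr>blk := (blk (E i))(h := max (blk (E i) h) (j^2))\<rparr> else E i));
         C = (\<lambda>i. nbrs n i - {h. j \<le> blk (E2 i) h});
         drawH = (\<lambda>i. if C i = {} then return_pmf None else map_pmf Some (pmf_of_set (C i)));
         upd = (\<lambda>i ho. case ho of
                  None \<Rightarrow> (E2 i)\<lparr>pcnt := cnt (E2 i), prv := None\<rparr>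
                | Some h \<Rightarrow>
                    (let R = (if h \<le> n then B h else mal_rec n tbI tbB j i (E i));
                         a = E2 i;
                         a' = (if R \<notin> active a
                               then a\<lparr>uu := tbU (argmax_set {uu a, ll a} (\<lambda>k. real (cnt a k - pcnt a k))),
                                      ll := R\<rparr>
                               else a)
                     in a'\<lparr>pcnt := cnt a, prv := Some (h, R)\<rparr>))
     in map_pmf (\<lambda>Hs i. if i \<in> {1..n} then upd i (Hs i) else \<sigma> i) (Pi_pmf {1..n} None drawH))"

definition init_st :: "(nat \<Rightarrow> nat) \<Rightarrow> (nat \<Rightarrow> nat) \<Rightarrow> (nat \<Rightarrow> nat) \<Rightarrow> nat \<Rightarrow> agst" where
  "init_st s u0 l0 i = \<lparr>stk = s i, uu = u0 i, ll = l0 i, cnt = (\<lambda>_. 0), rsm = (\<lambda>_. 0),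
                        pcnt = (\<lambda>_. 0), blk = (\<lambda>_. 0), prv = None\<rparr>"

(* stp ... j = distribution of the global state at the start of phase j+1 *)
primrec stp :: "nat \<Rightarrow> (nat set \<Rightarrow> nat) \<Rightarrow> (nat set \<Rightarrow> nat) \<Rightarrow> (nat set \<Rightarrow> nat)
                 \<Rightarrow> (nat \<Rightarrow> nat) \<Rightarrow> (nat \<Rightarrow> nat) \<Rightarrow> (nat \<Rightarrow> nat) \<Rightarrow> nat \<Rightarrow> (nat \<Rightarrow> agst) pmf" where
  "stp n tbI tbB tbU s u0 l0 0 = return_pmf (init_st s u0 l0)"
| "stp n tbI tbB tbU s u0 l0 (Suc j) =
     bind_pmf (stp n tbI tbB tbU s u0 l0 j) (trans n tbI tbB tbU (Suc j))"

definition phase_of :: "nat \<Rightarrow> nat" where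
  "phase_of t = (LEAST j. t \<le> j^2)"

(* arm pulled by agent i at time t, given the global state at the start of t's phase *)
definition pulled :: "nat \<Rightarrow> (nat set \<Rightarrow> nat) \<Rightarrow> nat \<Rightarrow> nat \<Rightarrow> (nat \<Rightarrow> agst) \<Rightarrow> nat" where
  "pulled n tbI i t \<sigma> = (let j = phase_of t in
     pick tbI t (upto n tbI (\<sigma> i) ((j-1)^2) (t - (j-1)^2 - 1)))"

definition regret :: "nat \<Rightarrow> (nat set \<Rightarrow> nat) \<Rightarrow> (nat set \<Rightarrow> nat) \<Rightarrow> (nat set \<Rightarrow> nat)
                      \<Rightarrow> (nat \<Rightarrow> nat) \<Rightarrow> (nat \<Rightarrow> nat) \<Rightarrow> (nat \<Rightarrow> nat) \<Rightarrow> nat \<Rightarrow> nat \<Rightarrow> real" where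
  "regret n tbI tbB tbU s u0 l0 i T =
     (\<Sum>t=1..T. measure_pmf.expectation (stp n tbI tbB tbU s u0 l0 (phase_of t - 1))
                  (\<lambda>\<sigma>. mu n 1 - mu n (pulled n tbI i t \<sigma>)))"

definition tie_rule :: "(nat set \<Rightarrow> nat) \<Rightarrow> bool" where
  "tie_rule tb \<longleftrightarrow> (\<forall>A. finite A \<and> A \<noteq> {} \<longrightarrow> tb A \<in> A)"

end

theory Submission
  imports Defs
begin

text \<open>
  Write \<open>p = n / 2\<close>. As long as agent \<open>n\<close> does not hold arm 1, each of its pulls costs at least
  \<open>1/15\<close>, so the task is to delay arm 1 with sufficient probability. Consider \<open>q = p + l + 1\<close> at phase
  \<open>J\<^sub>l\<close>, with \<open>q\<close> and everybody to its right holding only arms \<open>\<ge> p + 2 - l\<close>. Suppose that \<open>q\<close> draws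
  \<open>q + 1\<close> (and learns nothing), while \<open>q + 1\<close> draws the malicious agent and receives the slightly better
  arm \<open>a = p + 1 - l\<close>. One phase later \<open>q + 1\<close> draws \<open>q\<close>, which recommends an arm other than \<open>a\<close>,
  and \<open>q + 2\<close> draws \<open>q + 1\<close> and so receives \<open>a\<close>. The means are spread enough for UCB to play \<open>a\<close>
  most, so \<open>q + 1\<close> blocks \<open>q\<close> from phase \<open>J\<^sub>l + 2\<close> up to phase \<open>(J\<^sub>l + 2)\<^sup>2 = J\<^bsub>l+1\<^esub>\<close>. Since
  \<open>q + 1\<close> and \<open>q + 2\<close> now agree on \<open>a\<close>, they do not block each other, and at \<open>J\<^bsub>l+1\<^esub>\<close> the situation
  recurs one agent further right. A stage prescribes four draws of probability at least \<open>1/3\<close>, so the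
  first \<open>l\<close> stages succeed with probability at least a constant times \<open>81\<^bsup>-l\<^esup>\<close>, whereas
  \<open>log J\<^sub>l\<close> is of order \<open>2\<^sup>l\<close>; this gives \<open>T / log\<^sup>7 T\<close> because \<open>81 < 2\<^sup>7\<close>, and \<open>exp (exp (n/3))\<close>
  because \<open>exp (2/3) < 2\<close>. The term \<open>log T\<close> holds on every sample path: UCB keeps pulling the
  sticky arm of agent \<open>n\<close>, whose mean is 0.
\<close>

section \<open>One agent during one phase\<close>

lemma finite_active [simp]: "finite (active a)"
  by (simp add: active_def)

lemma active_nonempty [simp]: "active a \<noteq> {}"
  by (simp add: active_def)

lemma argmax_set_subset: "argmax_set S f \<subseteq> S"
  by (auto simp: argmax_set_def)

lemma argmax_set_nonempty:
  assumes "finite S" "S \<noteq> {}"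
  shows "argmax_set S f \<noteq> {}"
proof -
  from assms have "Max (f ` S) \<in> f ` S" by simp
  then obtain k where "k \<in> S" "f k = Max (f ` S)" by force
  then show ?thesis using assms by (auto simp: argmax_set_def)
qed

lemma argmax_set_strict:
  assumes "b \<in> S" "\<And>k. k \<in> S \<Longrightarrow> k \<noteq> b \<Longrightarrow> f k < f b"
  shows "argmax_set S f = {b}"
  using assms by (fastforce simp: argmax_set_def)

lemma tie_rule_mem: "tie_rule tb \<Longrightarrow> finite A \<Longrightarrow> A \<noteq> {} \<Longrightarrow> tb A \<in> A"
  by (simp add: tie_rule_def)

lemma tie_rule_argmax:
  "tie_rule tb \<Longrightarrow> finite S \<Longrightarrow> S \<noteq> {} \<Longrightarrow> tb (argmax_set S f) \<in> S"
  using tie_rule_mem[of tb "argmax_set S f"] argmax_set_nonempty[of S f] argmax_set_subset[of S f]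
    finite_subset by blast

lemma most_played_active: "tie_rule tbB \<Longrightarrow> most_played tbB a \<in> active a"
  by (simp add: most_played_def tie_rule_argmax)

lemma ucb_set_subset: "ucb_set t a \<subseteq> active a"
  using argmax_set_subset by (auto simp: ucb_set_def Let_def)

lemma ucb_set_nonempty: "ucb_set t a \<noteq> {}"
proof (cases "\<exists>k\<in>active a. cnt a k = 0")
  case True
  then show ?thesis by (auto simp: ucb_set_def Let_def)
next
  case False
  then show ?thesis
    by (simp only: ucb_set_def Let_def if_False) (rule argmax_set_nonempty; simp)
qed

lemma pick_ucb: "tie_rule tbI \<Longrightarrow> pick tbI t a \<in> ucb_set t a"
  unfolding pick_def
  by (meson finite_active finite_subset tie_rule_mem ucb_set_nonempty ucb_set_subset)

lemma pick_active: "tie_rule tbI \<Longrightarrow> pick tbI t a \<in> active a"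
  using pick_ucb ucb_set_subset by blast

text \<open>Rewards are deterministic, so the empirical mean of an arm that has been pulled is
  exactly its mean; only the exploration bonus in the UCB index varies.\<close>

definition rewards_consistent :: "nat \<Rightarrow> agst \<Rightarrow> bool" where
  "rewards_consistent n a \<longleftrightarrow> (\<forall>k. rsm a k = real (cnt a k) * mu n k)"

text \<open>An unpulled active arm has infinite index. Hence the choice of an arm that was pulled
  before shows that every active arm was pulled, and the finite indices can be compared with true
  means in place of empirical ones.\<close>

lemma pick_index_ge:
  assumes "tie_rule tbI" "rewards_consistent n a" "b \<in> active a" "k = pick tbI t a" "cnt a k \<noteq> 0"
  shows "cnt a b \<noteq> 0"
    and "mu n b + sqrt (4 * ln (real t) / real (cnt a b))
          \<le> mu n k + sqrt (4 * ln (real t) / real (cnt a k))"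
proof -
  have k: "k \<in> ucb_set t a" using assms pick_ucb by blast
  have nz: "\<not> (\<exists>k\<in>active a. cnt a k = 0)"
    using k assms(5) by (auto simp: ucb_set_def Let_def split: if_splits)
  then show b: "cnt a b \<noteq> 0" using assms(3) by auto
  have "rsm a b / real (cnt a b) + sqrt (4 * ln (real t) / real (cnt a b))
        \<le> rsm a k / real (cnt a k) + sqrt (4 * ln (real t) / real (cnt a k))"
    using k nz assms(3) by (auto simp: ucb_set_def argmax_set_def Let_def)
  then show "mu n b + sqrt (4 * ln (real t) / real (cnt a b))
          \<le> mu n k + sqrt (4 * ln (real t) / real (cnt a k))"
    using assms(2,5) b by (simp add: rewards_consistent_def)
qed

section \<open>Pull counts along a run of steps\<close>

lemma lstep_simps [simp]:
  "stk (lstep n tbI t a) = stk a" "uu (lstep n tbI t a) = uu a" "ll (lstep n tbI t a) = ll a"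
  "pcnt (lstep n tbI t a) = pcnt a" "blk (lstep n tbI t a) = blk a" "prv (lstep n tbI t a) = prv a"
  by (simp_all add: lstep_def Let_def)

lemma upto_simps [simp]:
  "stk (upto n tbI a t m) = stk a" "uu (upto n tbI a t m) = uu a" "ll (upto n tbI a t m) = ll a"
  "pcnt (upto n tbI a t m) = pcnt a" "blk (upto n tbI a t m) = blk a"
  "prv (upto n tbI a t m) = prv a"
  by (induction m) simp_all

lemma active_upto [simp]: "active (upto n tbI a t m) = active a"
  by (simp add: active_def)

lemma run_phase_simps [simp]:
  "stk (run_phase n tbI j a) = stk a" "uu (run_phase n tbI j a) = uu a"
  "ll (run_phase n tbI j a) = ll a" "pcnt (run_phase n tbI j a) = pcnt a"
  "blk (run_phase n tbI j a) = blk a" "prv (run_phase n tbI j a) = prv a"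
  "active (run_phase n tbI j a) = active a"
  by (simp_all add: run_phase_def)

lemma cnt_lstep: "cnt (lstep n tbI t a) k = cnt a k + (if pick tbI t a = k then 1 else 0)"
  by (simp add: lstep_def Let_def)

lemma rewards_consistent_upto:
  "rewards_consistent n a \<Longrightarrow> rewards_consistent n (upto n tbI a t m)"
proof (induction m)
  case (Suc m)
  then show ?case
    by (auto simp: rewards_consistent_def lstep_def Let_def algebra_simps)
qed simp

lemma cnt_upto_le: "cnt (upto n tbI a t m) k \<le> cnt a k + m"
  by (induction m) (auto simp: cnt_lstep)

lemma cnt_upto_mono: "m \<le> m' \<Longrightarrow> cnt (upto n tbI a t m) k \<le> cnt (upto n tbI a t m') k"
  by (induction m' rule: dec_induct) (auto simp: cnt_lstep)

lemma cnt_upto_eq_card: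
  "cnt (upto n tbI a t m) k
    = cnt a k + card {r. r < m \<and> pick tbI (t + Suc r) (upto n tbI a t r) = k}"
proof (induction m)
  case (Suc m)
  have "{r. r < Suc m \<and> pick tbI (t + Suc r) (upto n tbI a t r) = k}
      = (if pick tbI (t + Suc m) (upto n tbI a t m) = k then insert m else id)
          {r. r < m \<and> pick tbI (t + Suc r) (upto n tbI a t r) = k}"
    by (auto simp: less_Suc_eq)
  then show ?case using Suc by (simp add: cnt_lstep)
qed simp

lemma sum_cnt_upto:
  assumes "tie_rule tbI"
  shows "(\<Sum>k\<in>active a. cnt (upto n tbI a t m) k) = (\<Sum>k\<in>active a. cnt a k) + m"
proof (induction m)
  case (Suc m)
  let ?k = "pick tbI (t + Suc m) (upto n tbI a t m)"
  have "?k \<in> active a" using pick_active[OF assms, of "t + Suc m" "upto n tbI a t m"] by simp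
  then have "(\<Sum>k\<in>active a. if ?k = k then 1 else 0::nat) = 1"
    by (subst sum.delta') auto
  then show ?case using Suc by (simp add: cnt_lstep sum.distrib)
qed simp

text \<open>Just before its last pull the arm has count at most \<open>M\<close>, and that pull adds
  one; the other term of the maximum covers a run in which the arm is never pulled.\<close>

lemma cnt_upto_bound:
  assumes "0 \<le> M"
    and "\<And>r. r < m \<Longrightarrow> pick tbI (t + Suc r) (upto n tbI a t r) = k
          \<Longrightarrow> real (cnt (upto n tbI a t r) k) \<le> M"
  shows "real (cnt (upto n tbI a t m) k) \<le> max (real (cnt a k)) (M + 1)"
  using assms(2)
proof (induction m)
  case (Suc m)
  then have IH: "real (cnt (upto n tbI a t m) k) \<le> max (real (cnt a k)) (M + 1)" by simp
  show ?case
  proof (cases "pick tbI (t + Suc m) (upto n tbI a t m) = k")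
    case True
    then have "real (cnt (upto n tbI a t m) k) \<le> M" using Suc.prems by blast
    then show ?thesis using True by (simp add: cnt_lstep)
  next
    case False
    then show ?thesis using IH by (simp add: cnt_lstep)
  qed
qed simp

section \<open>Pulls within one phase\<close>

lemma phase_length: "j \<ge> 1 \<Longrightarrow> j\<^sup>2 - (j - 1)\<^sup>2 = 2 * j - (1::nat)"
  by (cases j) (simp_all add: power2_eq_square)

lemma ln_phase_time:
  assumes "j \<ge> 1" "r < 2 * j - 1"
  shows "ln (real ((j - 1)\<^sup>2 + Suc r)) \<le> 2 * ln (real j)"
proof -
  have "(j - 1)\<^sup>2 + Suc r \<le> (j - 1)\<^sup>2 + (j\<^sup>2 - (j - 1)\<^sup>2)"
    using assms by (simp only: phase_length add_le_cancel_left)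
  also have "\<dots> = j\<^sup>2" by (rule le_add_diff_inverse) (simp add: power_mono)
  finally have "real ((j - 1)\<^sup>2 + Suc r) \<le> real (j\<^sup>2)" by (simp only: of_nat_le_iff)
  then have "ln (real ((j - 1)\<^sup>2 + Suc r)) \<le> ln (real (j\<^sup>2))" by (intro ln_mono) (simp_all only: of_nat_0_less_iff zero_less_Suc add_Suc_right)
  then show ?thesis using assms by (simp add: ln_realpow)
qed

text \<open>An active set has at most three arms, hence at most two besides
  \<open>b\<close>.\<close>

lemma sum_active_minus_le:
  assumes "b \<in> active a" "\<And>k. k \<in> active a \<Longrightarrow> k \<noteq> b \<Longrightarrow> f k \<le> M" "0 \<le> (M::real)"
  shows "(\<Sum>k\<in>active a. f k) \<le> f b + 2 * M"
proof -
  have "card (active a) \<le> 3" by (auto simp: active_def card_insert_if)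
  then have c: "card (active a - {b}) \<le> 2" using assms(1) by simp
  have "(\<Sum>k\<in>active a. f k) = f b + (\<Sum>k\<in>active a - {b}. f k)"
    using assms(1) by (simp add: sum.remove)
  also have "(\<Sum>k\<in>active a - {b}. f k) \<le> real (card (active a - {b})) * M"
    using assms(2) by (intro sum_bounded_above) auto
  also have "\<dots> \<le> 2 * M" using c assms(3) by (intro mult_right_mono) auto
  finally show ?thesis by simp
qed

text \<open>If UCB pulls an arm \<open>k'\<close> other than \<open>b\<close>, the bonus of
  \<open>k'\<close> must make up for the gap \<open>\<delta>\<close>, which forces its count to be
  at most \<open>M = 8 * ln j / \<delta>\<^sup>2\<close>. So each other arm gains at most
  \<open>M + 1\<close> pulls in the phase, and of the \<open>2 * j - 1\<close> pulls more than
  \<open>M + 1\<close> remain for \<open>b\<close>.\<close>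

lemma dominance:
  assumes tie: "tie_rule tbI" and wf: "rewards_consistent n a" and b: "b \<in> active a"
    and d: "\<delta> > 0" "\<And>k. k \<in> active a \<Longrightarrow> k \<noteq> b \<Longrightarrow> mu n k + \<delta> \<le> mu n b"
    and j: "j \<ge> 1" "3 * (8 * ln (real j) / \<delta>\<^sup>2 + 1) < 2 * real j - 1"
    and k: "k \<in> active a" "k \<noteq> b"
  shows "cnt (run_phase n tbI j a) k - cnt a k < cnt (run_phase n tbI j a) b - cnt a b"
proof -
  define M where "M = 8 * ln (real j) / \<delta>\<^sup>2"
  define t where "t = (j - 1)\<^sup>2"
  define m where "m = 2 * j - 1"
  have M0: "0 \<le> M" using j by (simp add: M_def)
  have E: "run_phase n tbI j a = upto n tbI a t m"
    using j by (simp only: run_phase_def t_def m_def phase_length)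
  have bound: "real (cnt (upto n tbI a t m) k') - real (cnt a k') \<le> M + 1"
    if k': "k' \<in> active a" "k' \<noteq> b" for k'
  proof -
    have "real (cnt (upto n tbI a t m) k') \<le> max (real (cnt a k')) (M + 1)"
    proof (rule cnt_upto_bound[OF M0])
      fix r assume r: "r < m" "pick tbI (t + Suc r) (upto n tbI a t r) = k'"
      let ?c = "real (cnt (upto n tbI a t r) k')" and ?L = "ln (real (t + Suc r))"
      show "?c \<le> M"
      proof (cases "cnt (upto n tbI a t r) k' = 0")
        case False
        have "mu n b + sqrt (4 * ?L / real (cnt (upto n tbI a t r) b)) \<le> mu n k' + sqrt (4 * ?L / ?c)"
          using pick_index_ge(2)[OF tie rewards_consistent_upto[OF wf] _ r(2)[symmetric] False, of b] b by simp
        moreover have L0: "?L \<ge> 0" by simp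
        ultimately have "mu n b \<le> mu n k' + sqrt (4 * ?L / ?c)"
          by (smt (verit) divide_nonneg_nonneg of_nat_0_le_iff real_sqrt_ge_zero)
        then have "\<delta> \<le> sqrt (4 * ?L / ?c)" using d(2)[OF k'] by linarith
        then have "\<delta>\<^sup>2 \<le> 4 * ?L / ?c"
          using d(1) by (metis less_eq_real_def real_sqrt_le_iff real_sqrt_unique)
        then have "?c * \<delta>\<^sup>2 \<le> 4 * ?L" using False by (simp add: field_simps)
        also have "\<dots> \<le> 8 * ln (real j)"
          using ln_phase_time[OF j(1), of r] r by (simp add: t_def m_def)
        finally show ?thesis using d(1) by (simp add: M_def field_simps)
      qed (use M0 in simp)
    qed
    then show ?thesis using M0 by linarith
  qed
  have mono: "cnt a k' \<le> cnt (upto n tbI a t m) k'" for k'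
    using cnt_upto_mono[of 0 m] by simp
  define f where "f k' = real (cnt (upto n tbI a t m) k') - real (cnt a k')" for k'
  have "real (\<Sum>k\<in>active a. cnt (upto n tbI a t m) k) = real ((\<Sum>k\<in>active a. cnt a k) + m)"
    using sum_cnt_upto[OF tie] by simp
  then have "(\<Sum>k\<in>active a. f k) = real m" by (simp add: f_def sum_subtractf)
  moreover have "(\<Sum>k\<in>active a. f k) \<le> f b + 2 * (M + 1)"
    using bound M0 b by (intro sum_active_minus_le) (auto simp: f_def)
  ultimately have "f b \<ge> 2 * real j - 1 - 2 * (M + 1)" using j(1) by (simp add: m_def of_nat_diff)
  moreover have "f k \<le> M + 1" using bound k by (simp add: f_def)
  ultimately have "f k < f b" using j(2) by (simp add: M_def)
  then show ?thesis using mono[of k] mono[of b] by (simp add: E f_def)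
qed

text \<open>Even an arm of mean 0 is explored logarithmically often. If its count stayed below
  \<open>ln j / 4\<close>, its bonus would be at least 4 throughout the phase; as means are at most
  1, a competitor could be pulled only with bonus at least 3, that is, with count at most
  \<open>8/9 * ln j\<close>. The other two arms could then not absorb all pulls of the
  phase.\<close>

lemma sticky_count_lower:
  assumes tie: "tie_rule tbI" and wf: "rewards_consistent n a"
    and mu: "\<And>k. mu n k \<le> 1" and s: "mu n (stk a) = 0" and j: "j \<ge> 3"
  shows "real (cnt (run_phase n tbI j a) (stk a)) \<ge> ln (real j) / 4"
proof (rule ccontr)
  define t where "t = (j - 1)\<^sup>2"
  define m where "m = 2 * j - 1"
  have E: "run_phase n tbI j a = upto n tbI a t m"
    using j phase_length[of j] by (simp add: run_phase_def t_def m_def)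
  assume "\<not> ?thesis"
  then have less: "real (cnt (upto n tbI a t m) (stk a)) < ln (real j) / 4" by (simp add: E)
  have lnj: "ln (real j) \<ge> 0" using j by simp
  have bound: "real (cnt (upto n tbI a t m) k') - real (cnt a k') \<le> ln (real j) + 1"
    if k': "k' \<in> active a" "k' \<noteq> stk a" for k'
  proof -
    have "real (cnt (upto n tbI a t m) k') \<le> max (real (cnt a k')) (ln (real j) + 1)"
    proof (rule cnt_upto_bound[OF lnj])
      fix r assume r: "r < m" "pick tbI (t + Suc r) (upto n tbI a t r) = k'"
      let ?c = "real (cnt (upto n tbI a t r) k')" and ?L = "ln (real (t + Suc r))"
      let ?d = "real (cnt (upto n tbI a t r) (stk a))"
      show "?c \<le> ln (real j)"
      proof (cases "cnt (upto n tbI a t r) k' = 0")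
        case False
        have d0: "?d \<noteq> 0"
          using pick_index_ge(1)[OF tie rewards_consistent_upto[OF wf] _ r(2)[symmetric] False, of "stk a"]
          by (simp add: active_def)
        have "mu n (stk a) + sqrt (4 * ?L / ?d) \<le> mu n k' + sqrt (4 * ?L / ?c)"
          using pick_index_ge(2)[OF tie rewards_consistent_upto[OF wf] _ r(2)[symmetric] False, of "stk a"]
          by (simp add: active_def)
        then have i: "sqrt (4 * ?L / ?d) \<le> 1 + sqrt (4 * ?L / ?c)" using s mu[of k'] by linarith
        \<comment> \<open>The first time of phase \<open>j\<close> is
          \<open>(j - 1)\<^sup>2 + 1\<close>, which is already at least \<open>j\<close>; thus the
          logarithm of the time never falls below \<open>ln j\<close>.\<close>
        have "j \<le> t + Suc r"
        proof -
          obtain i where "j = i + 3" using j by (metis add.commute le_Suc_ex)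
          then show ?thesis by (simp add: t_def power2_eq_square)
        qed
        then have L: "ln (real j) \<le> ?L" using j by (subst ln_le_cancel_iff) auto
        have "?d \<le> real (cnt (upto n tbI a t m) (stk a))"
          using cnt_upto_mono[of r m] r by simp
        then have "16 * ?d \<le> 4 * ?L" using less L by linarith
        then have "16 \<le> 4 * ?L / ?d" using d0 by (simp add: field_simps)
        then have "4 \<le> sqrt (4 * ?L / ?d)" by (intro real_le_rsqrt) simp
        then have "3 \<le> sqrt (4 * ?L / ?c)" using i by linarith
        moreover have "sqrt 9 = (3::real)" by (rule real_sqrt_unique) simp_all
        ultimately have "9 \<le> 4 * ?L / ?c" by (metis real_sqrt_le_iff)
        then have "9 * ?c \<le> 4 * ?L" using False by (simp add: field_simps)
        also have "\<dots> \<le> 8 * ln (real j)"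
          using ln_phase_time[of j r] r j by (simp add: t_def m_def)
        finally show ?thesis using lnj by linarith
      qed (use lnj in simp)
    qed
    then show ?thesis using lnj by linarith
  qed
  define f where "f k' = real (cnt (upto n tbI a t m) k') - real (cnt a k')" for k'
  have "real (\<Sum>k\<in>active a. cnt (upto n tbI a t m) k) = real ((\<Sum>k\<in>active a. cnt a k) + m)"
    using sum_cnt_upto[OF tie] by simp
  then have "(\<Sum>k\<in>active a. f k) = real m" by (simp add: f_def sum_subtractf)
  moreover have "(\<Sum>k\<in>active a. f k) \<le> f (stk a) + 2 * (ln (real j) + 1)"
    using bound lnj by (intro sum_active_minus_le) (auto simp: f_def active_def)
  moreover have "f (stk a) < ln (real j) / 4" using less by (simp add: f_def)
  ultimately have "2 * real j - 1 < ln (real j) / 4 + 2 * (ln (real j) + 1)"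
    using j by (simp add: m_def of_nat_diff)
  \<comment> \<open>The tangent of the logarithm at 3 is sharp enough: with
    \<open>ln 3 \<le> 1.2\<close> the derived inequality reads 5 < 4.7 at \<open>j = 3\<close>, and
    its left side grows faster in \<open>j\<close>.\<close>
  moreover have "ln (real j) \<le> ln 3 + (real j - 3) / 3"
    using ln_le_minus_one[of "real j / 3"] j by (simp add: ln_div field_simps)
  moreover have "ln 3 \<le> (1.2 :: real)"
  proof -
    have "ln (3/2::real) \<le> 1/2" using ln_le_minus_one[of "3/2::real"] by simp
    moreover have "ln (3::real) = ln (3/2) + ln 2" by (simp add: ln_div)
    ultimately show ?thesis using ln2_le_25_over_36 by simp
  qed
  moreover have "real j \<ge> 3" using j by simp
  ultimately show False by argo
qed

section \<open>Means and phase sequence\<close>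

text \<open>Comparison with the geometric series of ratio 1/16. Together with the offset 13/15 it
  keeps every arm except arm 1 at mean at most 14/15, hence at gap at least 1/15.\<close>

lemma double_exponential_sum_le: "(\<Sum>h=1..N. (1/2::real) ^ (2 ^ (h+1))) \<le> 1/15"
proof -
  have four: "4 * h \<le> (2::nat) ^ (h + 1)" if "h \<ge> 1" for h
    using that by (induction h rule: nat_induct_at_least) auto
  have "(1/2::real) ^ (2 ^ (h+1)) \<le> (1/16) ^ h" if "h \<in> {1..N}" for h
  proof -
    have "(1/2::real) ^ (2 ^ (h+1)) \<le> (1/2) ^ (4 * h)"
      by (rule power_decreasing) (use four that in auto)
    also have "\<dots> = (1/16) ^ h" by (simp add: power_mult power_divide)
    finally show ?thesis .
  qed
  then have "(\<Sum>h=1..N. (1/2::real) ^ (2 ^ (h+1))) \<le> (\<Sum>h=1..N. (1/16) ^ h)"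
    by (rule sum_mono)
  also have "(\<Sum>h=1..N. (1/16::real) ^ h) = (1 - (1/16) ^ N) / 15"
  proof (induction N)
    case (Suc N)
    have "(1/16::real) ^ Suc N = (1/16) ^ N / 16" by simp
    moreover have "(\<Sum>h=1..Suc N. (1/16::real) ^ h) = (\<Sum>h=1..N. (1/16) ^ h) + (1/16) ^ Suc N"
      by simp
    ultimately show ?case using Suc by argo
  qed simp
  also have "\<dots> \<le> 1/15" by simp
  finally show ?thesis .
qed

lemma mu_suboptimal: "k \<noteq> 1 \<Longrightarrow> mu n k \<le> 14/15"
  using double_exponential_sum_le[of "n div 2 - k"] by (auto simp: mu_def)

lemma mu_le_1: "mu n k \<le> 1"
  using mu_suboptimal[of k n] by (cases "k = 1") (auto simp: mu_def)

lemma mu_one [simp]: "mu n (Suc 0) = 1"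
  by (simp add: mu_def)

lemma mu_antimono: "2 \<le> k \<Longrightarrow> k \<le> k' \<Longrightarrow> mu n k' \<le> mu n k"
  by (auto simp: mu_def intro!: sum_mono2 sum_nonneg add_nonneg_nonneg)

section \<open>Growth of the release phases\<close>

lemma Jseq_Suc: "l \<ge> 1 \<Longrightarrow> Jseq (Suc l) = (Jseq l + 2)\<^sup>2"
  by (cases l) auto

lemma Jseq_less_Suc: "Jseq l < Jseq (Suc l)"
  by (cases l) (auto simp: power2_eq_square)

lemma strict_mono_Jseq: "strict_mono Jseq"
  by (simp add: strict_mono_Suc_iff Jseq_less_Suc)

lemma Jseq_eq_iff [simp]: "Jseq l = Jseq l' \<longleftrightarrow> l = l'"
  using strict_mono_eq[OF strict_mono_Jseq] by simp

text \<open>The start value is \<open>2 ^ 2 ^ 3\<close>, and each squaring doubles the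
  exponent.\<close>

lemma Jseq_ge: "l \<ge> 1 \<Longrightarrow> 2 ^ 2 ^ (l + 2) \<le> Jseq l"
proof (induction l rule: nat_induct_at_least)
  case (Suc l)
  have "(2::nat) ^ 2 ^ (Suc l + 2) = (2 ^ 2 ^ (l + 2))\<^sup>2"
    by (simp add: power_mult[symmetric] mult.commute)
  also have "\<dots> \<le> (Jseq l + 2)\<^sup>2" using Suc by (intro power_mono) auto
  finally show ?case using Suc by (simp add: Jseq_Suc)
qed auto

lemma Jseq_ge_256: "l \<ge> 1 \<Longrightarrow> 256 \<le> Jseq l"
  using monoD[OF strict_mono_mono[OF strict_mono_Jseq], of 1 l] by simp

lemma ln_256: "ln (256::real) \<le> 50/9"
proof -
  have "ln (256::real) = ln (2 ^ 8)" by simp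
  also have "\<dots> = 8 * ln 2" by (simp only: ln_realpow)
  finally show ?thesis using ln2_le_25_over_36 by simp
qed

text \<open>For \<open>1 \<le> l\<close> and \<open>l < p\<close> this is the exact difference
  between the means of arm \<open>p + 1 - l\<close>, released at stage \<open>l\<close>, and its
  successor \<open>p + 2 - l\<close>. At \<open>l = 1\<close> the successor has mean 0; later the
  means differ by the last summand only.\<close>

definition stage_gap :: "nat \<Rightarrow> real" where
  "stage_gap l = (if l = 1 then 13/15 else (1/2) ^ (2 ^ l))"

lemma stage_gap_pos: "stage_gap l > 0"
  by (simp add: stage_gap_def)

lemma mu_stage_gap:
  assumes "1 \<le> l" "l < p" "p + 2 - l \<le> k"
  shows "mu (2 * p) k + stage_gap l \<le> mu (2 * p) (p + 1 - l)"
proof -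
  have "mu (2 * p) k \<le> mu (2 * p) (p + 2 - l)" using assms by (intro mu_antimono) auto
  also have "mu (2 * p) (p + 2 - l) + stage_gap l = mu (2 * p) (p + 1 - l)"
  proof (cases "l = 1")
    case False
    define i where "i = l - 2"
    have l: "l = Suc (Suc i)" using assms False by (simp add: i_def)
    obtain d where "p = l + d" "d \<ge> 1" using assms by (metis less_imp_add_positive Suc_leI One_nat_def)
    then have "p = Suc (Suc i) + d" "d \<ge> 1" by (simp_all add: l)
    then show ?thesis by (simp add: l mu_def stage_gap_def)
  qed (use assms in \<open>simp add: mu_def stage_gap_def\<close>)
  finally show ?thesis by simp
qed

text \<open>The length condition of \<open>dominance\<close>. The inverse squared gap is at most the
  square root of \<open>j\<close> from phase \<open>Jseq l\<close> on, so the exploration needed is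
  of order \<open>sqrt j * ln j\<close>. Bounding the logarithm by its tangent at 256 makes this
  explicit.\<close>

lemma stage_phase_length:
  assumes "l \<ge> 1" "Jseq l \<le> j"
  shows "3 * (8 * ln (real j) / (stage_gap l)\<^sup>2 + 1) < 2 * real j - 1"
proof (cases "l = 1")
  case True
  then have j: "real j \<ge> 256" using assms by simp
  have "ln (real j) \<le> ln 256 + (real j - 256) / 256"
    using ln_le_minus_one[of "real j / 256"] j by (simp add: ln_div field_simps)
  then have "24 * (225/169) * ln (real j) + 3 < 2 * real j - 1" using ln_256 j by argo
  then show ?thesis using True by (simp add: stage_gap_def power2_eq_square)
next
  case False
  then have l: "l \<ge> 2" using assms by simp
  define r where "r = sqrt (real j)"
  have "(2::nat) ^ 2 ^ (l + 2) \<le> j" using Jseq_ge[of l] assms by simp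
  then have "(2::real) ^ 2 ^ (l + 2) \<le> real j"
    by (metis of_nat_le_iff of_nat_numeral of_nat_power)
  moreover have "(2::real) ^ 2 ^ (l + 2) = (2 ^ 2 ^ (l + 1))\<^sup>2"
    by (simp add: power_mult[symmetric] mult.commute)
  ultimately have "((2::real) ^ 2 ^ (l + 1))\<^sup>2 \<le> real j" by (simp only:)
  \<comment> \<open>The left side equals \<open>1 / (stage_gap l)\<^sup>2\<close>, as computed
    below.\<close>
  then have gr: "(2::real) ^ 2 ^ (l + 1) \<le> r"
    unfolding r_def by (rule real_le_rsqrt)
  have "(2::real) ^ 8 \<le> 2 ^ 2 ^ (l + 1)"
  proof (rule power_increasing)
    have "(2::nat) ^ 3 \<le> 2 ^ (l + 1)" using l by (intro power_increasing) auto
    then show "8 \<le> (2::nat) ^ (l + 1)" by simp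
  qed simp
  then have r: "r \<ge> 256" using gr by simp
  have j: "real j = r\<^sup>2" by (simp add: r_def)
  have "ln (real j) = 2 * ln r" using r by (simp add: j ln_realpow)
  moreover have "ln r \<le> ln 256 + (r - 256) / 256"
    using ln_le_minus_one[of "r / 256"] r by (simp add: ln_div field_simps)
  ultimately have lnj: "ln (real j) \<le> 2 * (50/9 + (r - 256) / 256)" using ln_256 by argo
  have "1 / (stage_gap l)\<^sup>2 = 2 ^ 2 ^ (l + 1)"
    using False by (simp add: stage_gap_def power_divide power_mult[symmetric] mult.commute)
  then have "8 * ln (real j) / (stage_gap l)\<^sup>2 = 8 * ln (real j) * 2 ^ 2 ^ (l + 1)"
    by (metis divide_inverse inverse_eq_divide)
  also have "\<dots> \<le> 8 * (2 * (50/9 + (r - 256) / 256)) * r"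
    using lnj gr r j by (intro mult_mono) auto
  finally have "3 * (8 * ln (real j) / (stage_gap l)\<^sup>2 + 1)
      \<le> 48 * (50/9 + (r - 256) / 256) * r + 3" by argo
  also have "\<dots> < 2 * r\<^sup>2 - 1"
  proof -
    have "256 * r \<le> r\<^sup>2" using r by (simp add: power2_eq_square)
    moreover have "48 * (50/9 + (r - 256) / 256) * r + 3 = 656/3 * r + 3/16 * r\<^sup>2 + 3"
      by (simp add: field_simps power2_eq_square)
    ultimately show ?thesis using r by argo
  qed
  finally show ?thesis by (simp add: j)
qed

lemma stage_dominance:
  assumes "tie_rule tbI" "rewards_consistent (2 * p) a" "1 \<le> l" "l < p" "Jseq l \<le> j"
    and "p + 1 - l \<in> active a" "active a \<subseteq> {p + 1 - l..}" "k \<in> active a" "k \<noteq> p + 1 - l"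
  shows "cnt (run_phase (2 * p) tbI j a) k - cnt a k
       < cnt (run_phase (2 * p) tbI j a) (p + 1 - l) - cnt a (p + 1 - l)"
proof (rule dominance[where \<delta> = "stage_gap l"])
  show "mu (2 * p) k' + stage_gap l \<le> mu (2 * p) (p + 1 - l)"
    if "k' \<in> active a" "k' \<noteq> p + 1 - l" for k'
    using that assms by (intro mu_stage_gap) (auto simp: subset_iff le_less)
  show "1 \<le> j" using Jseq_ge_256[of l] assms by simp
qed (use assms stage_gap_pos stage_phase_length in auto)

section \<open>One transition of the system\<close>

lemma nbrs_subset: "i \<le> n \<Longrightarrow> nbrs n i \<subseteq> {i - 1, i + 1, n + 1}"
  by (auto simp: nbrs_def Eset_def)

lemma nbrs_mem:
  assumes "1 \<le> i" "i \<le> n"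
  shows "n + 1 \<in> nbrs n i" "2 \<le> i \<Longrightarrow> i - 1 \<in> nbrs n i" "i < n \<Longrightarrow> i + 1 \<in> nbrs n i"
  using assms by (auto simp: nbrs_def Eset_def)

lemma nbrs_honest:
  assumes "h \<in> nbrs n i" "h \<le> n" "i \<le> n"
  shows "h \<in> {1..n}" "h = i - 1 \<and> 2 \<le> i \<or> h = i + 1"
  using assms by (auto simp: nbrs_def Eset_def)

section \<open>Lower bounds for expectations and chained events\<close>

lemma expectation_ge:
  fixes f :: "'a \<Rightarrow> real"
  assumes "measure_pmf.prob M {x. P x} \<ge> c" "0 \<le> w" "\<And>x. 0 \<le> f x" "\<And>x. f x \<le> 1"
    and "\<And>x. x \<in> set_pmf M \<Longrightarrow> P x \<Longrightarrow> f x \<ge> w"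
  shows "measure_pmf.expectation M f \<ge> c * w"
proof -
  have "c * w \<le> measure_pmf.prob M {x. P x} * w" using assms by (intro mult_right_mono)
  also have "\<dots> = measure_pmf.expectation M (\<lambda>x. w * indicator {x. P x} x)" by simp
  also have "\<dots> \<le> measure_pmf.expectation M f"
  proof (rule integral_mono_AE)
    show "integrable (measure_pmf M) (\<lambda>x. w * indicator {x. P x} x :: real)"
      by (rule measure_pmf.integrable_const_bound[where B = w]) (use assms(2) in \<open>auto simp: indicator_def\<close>)
    show "integrable (measure_pmf M) f"
      by (rule measure_pmf.integrable_const_bound[where B = 1]) (use assms(3,4) in auto)
    show "AE x in measure_pmf M. w * indicator {x. P x} x \<le> f x"
      using assms(3,5) by (auto simp: AE_measure_pmf_iff indicator_def)
  qed
  finally show ?thesis .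
qed

text \<open>The multiplication rule for two consecutive random steps, phrased without conditional
  probabilities.\<close>

lemma prob_bind_ge:
  assumes "measure_pmf.prob M {x. P x} \<ge> c" "0 \<le> w"
    and "\<And>x. x \<in> set_pmf M \<Longrightarrow> P x \<Longrightarrow> measure_pmf.prob (f x) A \<ge> w"
  shows "measure_pmf.prob (bind_pmf M f) A \<ge> c * w"
proof -
  have "c * w \<le> measure_pmf.expectation M (\<lambda>x. measure_pmf.prob (f x) A)"
    by (rule expectation_ge[OF assms(1,2)]) (use assms(3) in auto)
  also have "\<dots> = measure_pmf.prob (bind_pmf M f) A"
    unfolding measure_pmf_bind
    by (rule measure_pmf.measure_bind[where N = "count_space UNIV", symmetric])
      (auto simp: measure_subprob)
  finally show ?thesis .
qed

section \<open>The instance and the pieces of one transition\<close>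

locale line_instance =
  fixes n p :: nat and tbI tbB tbU :: "nat set \<Rightarrow> nat" and s u0 l0 :: "nat \<Rightarrow> nat"
  assumes n_eq: "n = 2 * p" and p_ge: "2 \<le> p"
    and tieI: "tie_rule tbI" and tieB: "tie_rule tbB" and tieU: "tie_rule tbU"
    and init_right: "\<And>i. i \<in> {p + 1..n} \<Longrightarrow> p < s i \<and> p < u0 i \<and> p < l0 i"
begin

text \<open>This and the next definitions up to \<open>draw\<close> give names to the local bindings
  of \<open>trans\<close>, so that facts about single pieces can be stated; \<open>trans_eq\<close>
  then holds by unfolding.\<close>

definition finish :: "nat \<Rightarrow> (nat \<Rightarrow> agst) \<Rightarrow> nat \<Rightarrow> agst" where
  "finish j \<sigma> i = run_phase n tbI j (\<sigma> i)"

definition best :: "nat \<Rightarrow> (nat \<Rightarrow> agst) \<Rightarrow> nat \<Rightarrow> nat" where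
  "best j \<sigma> i = most_played tbB (finish j \<sigma> i)"

definition blocked :: "nat \<Rightarrow> (nat \<Rightarrow> agst) \<Rightarrow> nat \<Rightarrow> agst" where
  "blocked j \<sigma> i = (case prv (finish j \<sigma> i) of
       None \<Rightarrow> finish j \<sigma> i
     | Some (h, r) \<Rightarrow> (if 1 < j \<and> best j \<sigma> i \<noteq> r
          then finish j \<sigma> i\<lparr>blk := (blk (finish j \<sigma> i))(h := max (blk (finish j \<sigma> i) h) (j^2))\<rparr>
          else finish j \<sigma> i))"

definition cands :: "nat \<Rightarrow> (nat \<Rightarrow> agst) \<Rightarrow> nat \<Rightarrow> nat set" where
  "cands j \<sigma> i = nbrs n i - {h. j \<le> blk (blocked j \<sigma> i) h}"

definition recm :: "nat \<Rightarrow> (nat \<Rightarrow> agst) \<Rightarrow> nat \<Rightarrow> nat \<Rightarrow> nat" where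
  "recm j \<sigma> i h = (if h \<le> n then best j \<sigma> h else mal_rec n tbI tbB j i (finish j \<sigma> i))"

definition nxt :: "nat \<Rightarrow> (nat \<Rightarrow> agst) \<Rightarrow> nat \<Rightarrow> nat option \<Rightarrow> agst" where
  "nxt j \<sigma> i ho = (case ho of
       None \<Rightarrow> (blocked j \<sigma> i)\<lparr>pcnt := cnt (blocked j \<sigma> i), prv := None\<rparr>
     | Some h \<Rightarrow>
        (let R = recm j \<sigma> i h; a = blocked j \<sigma> i;
             a' = (if R \<notin> active a
                   then a\<lparr>uu := tbU (argmax_set {uu a, ll a} (\<lambda>k. real (cnt a k - pcnt a k))),
                          ll := R\<rparr>
                   else a)
         in a'\<lparr>pcnt := cnt a, prv := Some (h, R)\<rparr>))"

definition draw :: "nat \<Rightarrow> (nat \<Rightarrow> agst) \<Rightarrow> nat \<Rightarrow> nat option pmf" where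
  "draw j \<sigma> i = (if cands j \<sigma> i = {} then return_pmf None
                 else map_pmf Some (pmf_of_set (cands j \<sigma> i)))"

lemma trans_eq:
  "trans n tbI tbB tbU j \<sigma>
    = map_pmf (\<lambda>Hs i. if i \<in> {1..n} then nxt j \<sigma> i (Hs i) else \<sigma> i) (Pi_pmf {1..n} None (draw j \<sigma>))"
  unfolding trans_def Let_def nxt_def recm_def draw_def cands_def blocked_def best_def finish_def
  by (rule refl)

text \<open>One transition with its probabilities forgotten. \<open>None\<close> is allowed even if
  candidates exist, so the relation may exceed the support of \<open>trans\<close>; invariants
  proved for it hold on the support all the same.\<close>

definition succ :: "nat \<Rightarrow> (nat \<Rightarrow> agst) \<Rightarrow> (nat \<Rightarrow> agst) \<Rightarrow> bool" where
  "succ j \<sigma> \<sigma>' \<longleftrightarrow> (\<forall>i\<in>{1..n}. \<sigma>' i = nxt j \<sigma> i None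
                        \<or> (\<exists>h\<in>cands j \<sigma> i. \<sigma>' i = nxt j \<sigma> i (Some h)))"

lemma finish_simps [simp]:
  "stk (finish j \<sigma> i) = stk (\<sigma> i)" "uu (finish j \<sigma> i) = uu (\<sigma> i)" "ll (finish j \<sigma> i) = ll (\<sigma> i)"
  "pcnt (finish j \<sigma> i) = pcnt (\<sigma> i)" "blk (finish j \<sigma> i) = blk (\<sigma> i)"
  "prv (finish j \<sigma> i) = prv (\<sigma> i)" "active (finish j \<sigma> i) = active (\<sigma> i)"
  by (simp_all add: finish_def)

lemma blocked_simps [simp]:
  "stk (blocked j \<sigma> i) = stk (\<sigma> i)" "uu (blocked j \<sigma> i) = uu (\<sigma> i)"
  "ll (blocked j \<sigma> i) = ll (\<sigma> i)" "cnt (blocked j \<sigma> i) = cnt (finish j \<sigma> i)"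
  "rsm (blocked j \<sigma> i) = rsm (finish j \<sigma> i)"
  "pcnt (blocked j \<sigma> i) = pcnt (\<sigma> i)" "active (blocked j \<sigma> i) = active (\<sigma> i)"
  by (simp_all add: blocked_def active_def split: option.split)

text \<open>The blocking rule touches only the sender of the last recommendation, and only if the
  recommended arm was not the most played one.\<close>

lemma blk_blocked_unchanged:
  "(\<And>r. prv (\<sigma> i) = Some (h, r) \<Longrightarrow> best j \<sigma> i = r) \<Longrightarrow> blk (blocked j \<sigma> i) h = blk (\<sigma> i) h"
  by (auto simp: blocked_def split: option.split)

lemma blk_blocked_block:
  "prv (\<sigma> i) = Some (h, r) \<Longrightarrow> best j \<sigma> i \<noteq> r \<Longrightarrow> 1 < j \<Longrightarrow> blk (blocked j \<sigma> i) h \<ge> j\<^sup>2"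
  by (auto simp: blocked_def)

lemma blk_blocked_ge: "blk (\<sigma> i) h \<le> blk (blocked j \<sigma> i) h"
  by (auto simp: blocked_def split: option.split)

lemma blk_blocked_le: "blk (\<sigma> i) h \<le> M \<Longrightarrow> j\<^sup>2 \<le> M \<Longrightarrow> blk (blocked j \<sigma> i) h \<le> M"
  by (auto simp: blocked_def split: option.split)

lemma nxt_simps [simp]:
  "stk (nxt j \<sigma> i ho) = stk (\<sigma> i)" "cnt (nxt j \<sigma> i ho) = cnt (finish j \<sigma> i)"
  "rsm (nxt j \<sigma> i ho) = rsm (finish j \<sigma> i)" "pcnt (nxt j \<sigma> i ho) = cnt (finish j \<sigma> i)"
  "blk (nxt j \<sigma> i ho) = blk (blocked j \<sigma> i)"
  "prv (nxt j \<sigma> i ho) = map_option (\<lambda>h. (h, recm j \<sigma> i h)) ho"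
  by (simp_all add: nxt_def Let_def split: option.split)

lemma nxt_None_active: "active (nxt j \<sigma> i None) = active (\<sigma> i)"
  using blocked_simps(7)[of j \<sigma> i] by (simp add: nxt_def active_def)

lemma nxt_Some_old:
  assumes "recm j \<sigma> i h \<in> active (\<sigma> i)"
  shows "uu (nxt j \<sigma> i (Some h)) = uu (\<sigma> i)" "ll (nxt j \<sigma> i (Some h)) = ll (\<sigma> i)"
    "active (nxt j \<sigma> i (Some h)) = active (\<sigma> i)"
  using assms by (auto simp: nxt_def Let_def active_def)

lemma nxt_Some_new:
  assumes "recm j \<sigma> i h \<notin> active (\<sigma> i)"
  shows "active (nxt j \<sigma> i (Some h)) = {stk (\<sigma> i), recm j \<sigma> i h,
     tbU (argmax_set {uu (\<sigma> i), ll (\<sigma> i)} (\<lambda>k. real (cnt (finish j \<sigma> i) k - pcnt (\<sigma> i) k)))}"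
  using assms by (auto simp: nxt_def Let_def active_def)

lemma tbU_mem: "tbU (argmax_set {x, y} f) \<in> {x, y}"
  using tie_rule_argmax[OF tieU, of "{x,y}" f] by simp

lemma nxt_Some_active:
  "active (nxt j \<sigma> i (Some h)) \<subseteq> insert (recm j \<sigma> i h) (active (\<sigma> i))"
proof (cases "recm j \<sigma> i h \<in> active (\<sigma> i)")
  case True
  then show ?thesis using nxt_Some_old(3)[OF True] by auto
next
  case False
  then show ?thesis using nxt_Some_new[OF False] tbU_mem[of "uu (\<sigma> i)" "ll (\<sigma> i)"]
    by (auto simp: active_def)
qed

lemma recm_nxt_active: "recm j \<sigma> i h \<in> active (nxt j \<sigma> i (Some h))"
  using nxt_Some_old(3) nxt_Some_new by (cases "recm j \<sigma> i h \<in> active (\<sigma> i)") auto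

text \<open>A strictly most played arm is either sticky or the one of \<open>uu\<close> and
  \<open>ll\<close> that the update keeps. The equation \<open>pcnt = cnt\<close> makes count
  differences equal to pulls in the phase.\<close>

lemma dominant_nxt_active:
  assumes "b \<in> active (\<sigma> i)" "pcnt (\<sigma> i) = cnt (\<sigma> i)"
    and "\<And>k. k \<in> active (\<sigma> i) \<Longrightarrow> k \<noteq> b \<Longrightarrow>
      cnt (finish j \<sigma> i) k - cnt (\<sigma> i) k < cnt (finish j \<sigma> i) b - cnt (\<sigma> i) b"
  shows "b \<in> active (nxt j \<sigma> i ho)"
proof (cases ho)
  case None
  then show ?thesis using assms nxt_None_active by simp
next
  case (Some h)
  show ?thesis
  proof (cases "recm j \<sigma> i h \<in> active (\<sigma> i)")
    case True
    then show ?thesis using nxt_Some_old(3) Some assms by simp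
  next
    case False
    show ?thesis
    proof (cases "b = stk (\<sigma> i)")
      case True
      then show ?thesis by (simp add: active_def)
    next
      case bn: False
      then have "argmax_set {uu (\<sigma> i), ll (\<sigma> i)} (\<lambda>k. real (cnt (finish j \<sigma> i) k - pcnt (\<sigma> i) k)) = {b}"
        using assms by (intro argmax_set_strict) (auto simp: active_def)
      then show ?thesis using nxt_Some_new[OF False] Some tie_rule_mem[OF tieU, of "{b}"] by auto
    qed
  qed
qed

lemma dominant_best:
  assumes "b \<in> active (\<sigma> i)" "pcnt (\<sigma> i) = cnt (\<sigma> i)"
    and "\<And>k. k \<in> active (\<sigma> i) \<Longrightarrow> k \<noteq> b \<Longrightarrow>
      cnt (finish j \<sigma> i) k - cnt (\<sigma> i) k < cnt (finish j \<sigma> i) b - cnt (\<sigma> i) b"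
  shows "best j \<sigma> i = b"
proof -
  have "argmax_set (active (\<sigma> i)) (\<lambda>k. real (cnt (finish j \<sigma> i) k - pcnt (\<sigma> i) k)) = {b}"
    using assms by (intro argmax_set_strict) auto
  then show ?thesis using tieB using tie_rule_mem[OF tieB, of "{b}"] by (simp add: best_def most_played_def)
qed

lemma best_active: "best j \<sigma> i \<in> active (\<sigma> i)"
  using most_played_active[OF tieB, of "finish j \<sigma> i"] by (simp add: best_def)

definition scheduled :: "nat \<Rightarrow> nat \<Rightarrow> bool" where
  "scheduled j i \<longleftrightarrow> (\<exists>l\<in>{1..p - 1}. j = Jseq l \<and> (i = l + 1 + p \<or> i = l + 2 + p))"

text \<open>Injectivity of \<open>Jseq\<close> leaves a single matching stage, so the
  \<open>Min\<close> in \<open>mal_rec\<close> has nothing to choose.\<close>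

lemma mal_rec_scheduled:
  assumes "1 \<le> l" "l < p" "i = l + 1 + p \<or> i = l + 2 + p"
  shows "mal_rec n tbI tbB (Jseq l) i a = p + 1 - l"
proof -
  have "{l' \<in> {1..p - 1}. Jseq l = Jseq l' \<and> (i = l' + 1 + p \<or> i = l' + 2 + p)} = {l}"
    using assms by auto
  then show ?thesis by (simp add: mal_rec_def Let_def n_eq)
qed

lemma mal_rec_unscheduled:
  assumes "\<not> scheduled j i"
  shows "mal_rec n tbI tbB j i a = most_played tbB (run_phase n tbI (Suc j) (a\<lparr>pcnt := cnt a\<rparr>))"
proof -
  have e: "{l \<in> {1..n div 2 - 1}. j = Jseq l \<and> (i = l + 1 + n div 2 \<or> i = l + 2 + n div 2)} = {}"
    using assms by (auto simp: scheduled_def n_eq)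
  show ?thesis unfolding mal_rec_def Let_def e by simp
qed

end

section \<open>Prediction of the next phase by the malicious agent\<close>

lemma lstep_cong:
  assumes "active a = active b" "cnt a = cnt b" "rsm a = rsm b"
  shows "cnt (lstep n tbI t a) = cnt (lstep n tbI t b) \<and> rsm (lstep n tbI t a) = rsm (lstep n tbI t b)"
proof -
  have "ucb_set t a = ucb_set t b" using assms by (simp only: ucb_set_def)
  then show ?thesis using assms by (simp add: lstep_def pick_def Let_def)
qed

lemma upto_cong:
  assumes "active a = active b" "cnt a = cnt b" "rsm a = rsm b"
  shows "cnt (upto n tbI a t m) = cnt (upto n tbI b t m) \<and> rsm (upto n tbI a t m) = rsm (upto n tbI b t m)"
proof (induction m)
  case (Suc m)
  then show ?case using lstep_cong[of "upto n tbI a t m" "upto n tbI b t m"] assms by simp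
qed (use assms in simp)

text \<open>The prediction in \<open>mal_rec\<close> starts from a state whose \<open>blk\<close>
  and \<open>prv\<close> are not yet updated. Play does not depend on these fields, so the
  prediction agrees with what happens.\<close>

lemma most_played_run_phase_cong:
  assumes "active a = active b" "cnt a = cnt b" "rsm a = rsm b" "pcnt a = pcnt b"
  shows "most_played tbB (run_phase n tbI j a) = most_played tbB (run_phase n tbI j b)"
  using upto_cong[OF assms(1-3)] assms by (simp add: most_played_def run_phase_def)

context line_instance
begin

text \<open>Here \<open>\<sigma>\<close> is the state after phase \<open>j\<close>. The bound on
  \<open>blk\<close> holds because a block set in phase \<open>j\<close> lasts until
  \<open>j\<^sup>2\<close>; the bound on \<open>cnt\<close> later gives integrability.\<close>

definition wf_state :: "nat \<Rightarrow> (nat \<Rightarrow> agst) \<Rightarrow> bool" where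
  "wf_state j \<sigma> \<longleftrightarrow> (\<forall>i\<in>{1..n}. pcnt (\<sigma> i) = cnt (\<sigma> i) \<and> rewards_consistent n (\<sigma> i) \<and>
     (\<forall>k. cnt (\<sigma> i) k \<le> j\<^sup>2) \<and> (\<forall>h. blk (\<sigma> i) h \<le> j\<^sup>2) \<and> stk (\<sigma> i) = s i \<and>
     (\<forall>h r. prv (\<sigma> i) = Some (h, r) \<longrightarrow> r \<in> active (\<sigma> i)))"

lemma rewards_consistent_finish:
  "rewards_consistent n (\<sigma> i) \<Longrightarrow> rewards_consistent n (finish j \<sigma> i)"
  by (simp add: finish_def run_phase_def rewards_consistent_upto)

lemma succ_cases:
  assumes "succ j \<sigma> \<sigma>'" "i \<in> {1..n}"
  obtains "\<sigma>' i = nxt j \<sigma> i None" | h where "h \<in> cands j \<sigma> i" "\<sigma>' i = nxt j \<sigma> i (Some h)"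
  using assms unfolding succ_def by blast

lemma succ_nxt:
  assumes "succ j \<sigma> \<sigma>'" "i \<in> {1..n}"
  obtains ho where "\<sigma>' i = nxt j \<sigma> i ho"
  using assms unfolding succ_def by blast

lemma wf_succ:
  assumes wf: "wf_state j \<sigma>" and succ: "succ (Suc j) \<sigma> \<sigma>'"
  shows "wf_state (Suc j) \<sigma>'"
  unfolding wf_state_def
proof
  fix i assume i: "i \<in> {1..n}"
  have w: "rewards_consistent n (\<sigma> i)" "\<And>k. cnt (\<sigma> i) k \<le> j\<^sup>2" "\<And>h. blk (\<sigma> i) h \<le> j\<^sup>2" "stk (\<sigma> i) = s i"
    using wf i by (auto simp: wf_state_def)
  obtain ho where ho: "\<sigma>' i = nxt (Suc j) \<sigma> i ho" using succ_nxt[OF succ i] .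
  have jj: "j\<^sup>2 \<le> (Suc j)\<^sup>2" by (simp add: power_mono)
  have c: "cnt (finish (Suc j) \<sigma> i) k \<le> (Suc j)\<^sup>2" for k
  proof -
    have "cnt (finish (Suc j) \<sigma> i) k \<le> cnt (\<sigma> i) k + ((Suc j)\<^sup>2 - j\<^sup>2)"
      unfolding finish_def run_phase_def diff_Suc_1 by (rule cnt_upto_le)
    also have "\<dots> \<le> (Suc j)\<^sup>2" using w(2)[of k] jj by simp
    finally show ?thesis .
  qed
  have b: "blk (blocked (Suc j) \<sigma> i) h \<le> (Suc j)\<^sup>2" for h
    using blk_blocked_le[of \<sigma> i h "(Suc j)\<^sup>2" "Suc j"] w(3)[of h] jj by simp
  have r: "rewards_consistent n (\<sigma>' i)"
    using rewards_consistent_finish[of \<sigma> i "Suc j"] w(1) by (simp add: ho rewards_consistent_def)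
  have "r \<in> active (\<sigma>' i)" if "prv (\<sigma>' i) = Some (h, r)" for h r
    using that recm_nxt_active[of "Suc j" \<sigma> i h] by (auto simp: ho)
  then show "pcnt (\<sigma>' i) = cnt (\<sigma>' i) \<and> rewards_consistent n (\<sigma>' i) \<and>
     (\<forall>k. cnt (\<sigma>' i) k \<le> (Suc j)\<^sup>2) \<and> (\<forall>h. blk (\<sigma>' i) h \<le> (Suc j)\<^sup>2) \<and> stk (\<sigma>' i) = s i \<and>
     (\<forall>h r. prv (\<sigma>' i) = Some (h, r) \<longrightarrow> r \<in> active (\<sigma>' i))"
    using b c r w(4) by (simp add: ho)
qed

lemma succ_prv:
  assumes "succ j \<sigma> \<sigma>'" "i \<in> {1..n}" "prv (\<sigma>' i) = Some (h, r)"
  shows "h \<in> cands j \<sigma> i" "r = recm j \<sigma> i h" "\<sigma>' i = nxt j \<sigma> i (Some h)"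
proof -
  have "h \<in> cands j \<sigma> i \<and> r = recm j \<sigma> i h \<and> \<sigma>' i = nxt j \<sigma> i (Some h)"
    using assms(1,2)
  proof (cases rule: succ_cases)
    case 1
    then show ?thesis using assms(3) by simp
  next
    case (2 h')
    then show ?thesis using assms(3) by auto
  qed
  then show "h \<in> cands j \<sigma> i" "r = recm j \<sigma> i h" "\<sigma>' i = nxt j \<sigma> i (Some h)" by auto
qed

lemma succ_blk: "succ j \<sigma> \<sigma>' \<Longrightarrow> i \<in> {1..n} \<Longrightarrow> blk (\<sigma>' i) = blk (blocked j \<sigma> i)"
  by (erule succ_nxt) auto

lemma succ_active:
  assumes "succ j \<sigma> \<sigma>'" "i \<in> {1..n}" "active (\<sigma> i) \<subseteq> A"
    and "\<And>h. prv (\<sigma>' i) = Some (h, recm j \<sigma> i h) \<Longrightarrow> h \<in> cands j \<sigma> i \<Longrightarrow> recm j \<sigma> i h \<in> A"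
  shows "active (\<sigma>' i) \<subseteq> A"
  using assms(1,2)
proof (cases rule: succ_cases)
  case 1
  then show ?thesis using nxt_None_active assms(3) by simp
next
  case (2 h)
  then show ?thesis using nxt_Some_active[of j \<sigma> i h] assms(3) assms(4)[of h] by auto
qed

lemma recm_honest:
  assumes "h \<in> cands j \<sigma> i" "h \<le> n" "i \<le> n"
  shows "recm j \<sigma> i h \<in> active (\<sigma> h)" "h \<in> {1..n}" "h = i - 1 \<and> 2 \<le> i \<or> h = i + 1"
  using assms nbrs_honest[of h n i] best_active by (auto simp: recm_def cands_def)

text \<open>Off schedule the recommendation is the outcome of a simulated phase with the current
  active set, hence an arm of that set.\<close>

lemma recm_mal:
  assumes "\<not> scheduled j i" "\<not> h \<le> n"
  shows "recm j \<sigma> i h \<in> active (\<sigma> i)"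
  using assms most_played_active[OF tieB, of "run_phase n tbI (Suc j) (finish j \<sigma> i\<lparr>pcnt := cnt (finish j \<sigma> i)\<rparr>)"]
  by (simp add: recm_def mal_rec_unscheduled active_def)

text \<open>Says that \<open>i\<close> has never blocked the malicious agent and will not do so in
  the coming phase, which is phase \<open>Suc j\<close> because \<open>\<sigma>\<close> is the state
  after phase \<open>j\<close>.\<close>

definition malsafe :: "nat \<Rightarrow> (nat \<Rightarrow> agst) \<Rightarrow> nat \<Rightarrow> bool" where
  "malsafe j \<sigma> i \<longleftrightarrow> blk (\<sigma> i) (n + 1) = 0 \<and>
     (\<forall>r. prv (\<sigma> i) = Some (n + 1, r) \<longrightarrow> r = best (Suc j) \<sigma> i)"

lemma malsafe_blocked: "malsafe j \<sigma> i \<Longrightarrow> blk (blocked (Suc j) \<sigma> i) (n + 1) = 0"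
  using blk_blocked_unchanged[of \<sigma> i "n + 1" "Suc j"] by (auto simp: malsafe_def)

lemma malsafe_cands: "malsafe j \<sigma> i \<Longrightarrow> i \<in> {1..n} \<Longrightarrow> n + 1 \<in> cands (Suc j) \<sigma> i"
  using malsafe_blocked[of j \<sigma> i] nbrs_mem(1)[of i n] by (simp add: cands_def)

text \<open>An off-schedule recommendation is already active and leaves the active set unchanged, so
  the simulated phase is the real one and the predicted arm is indeed played most.\<close>

lemma malsafe_succ:
  assumes safe: "malsafe j \<sigma> i" and succ: "succ (Suc j) \<sigma> \<sigma>'" and i: "i \<in> {1..n}"
    and unsch: "\<not> scheduled (Suc j) i"
  shows "malsafe (Suc j) \<sigma>' i"
  unfolding malsafe_def
proof (intro conjI allI impI)
  show "blk (\<sigma>' i) (n + 1) = 0"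
    using succ_blk[OF succ i] malsafe_blocked[OF safe] by simp
next
  fix r assume r: "prv (\<sigma>' i) = Some (n + 1, r)"
  note f = succ_prv[OF succ i r]
  have old: "recm (Suc j) \<sigma> i (n + 1) \<in> active (\<sigma> i)" using recm_mal[OF unsch] by simp
  let ?F = "finish (Suc j) \<sigma> i"
  have "r = most_played tbB (run_phase n tbI (Suc (Suc j)) (?F\<lparr>pcnt := cnt ?F\<rparr>))"
    using f(2) unsch by (simp add: recm_def mal_rec_unscheduled)
  also have "\<dots> = most_played tbB (run_phase n tbI (Suc (Suc j)) (\<sigma>' i))"
  proof (rule most_played_run_phase_cong)
    show "active (?F\<lparr>pcnt := cnt ?F\<rparr>) = active (\<sigma>' i)"
      using nxt_Some_old(3)[OF old] finish_simps(7)[of "Suc j" \<sigma> i] by (simp add: f(3) active_def)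
  qed (simp_all add: f(3))
  finally show "r = best (Suc (Suc j)) \<sigma>' i" by (simp add: best_def finish_def)
qed

lemma stage_dominant:
  assumes "wf_state j \<sigma>" "i \<in> {1..n}" "1 \<le> l" "l < p" "Jseq l \<le> j'"
    and "p + 1 - l \<in> active (\<sigma> i)" "active (\<sigma> i) \<subseteq> {p + 1 - l..}"
  shows "best j' \<sigma> i = p + 1 - l" "p + 1 - l \<in> active (nxt j' \<sigma> i ho)"
proof -
  have w: "pcnt (\<sigma> i) = cnt (\<sigma> i)" "rewards_consistent n (\<sigma> i)"
    using assms by (auto simp: wf_state_def)
  have "cnt (finish j' \<sigma> i) k - cnt (\<sigma> i) k
      < cnt (finish j' \<sigma> i) (p + 1 - l) - cnt (\<sigma> i) (p + 1 - l)"
    if "k \<in> active (\<sigma> i)" "k \<noteq> p + 1 - l" for k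
    unfolding finish_def
    by (rule stage_dominance[OF tieI, of p "\<sigma> i" l j' k, folded n_eq]) (use assms that w(2) in auto)
  then show "best j' \<sigma> i = p + 1 - l" "p + 1 - l \<in> active (nxt j' \<sigma> i ho)"
    using dominant_best dominant_nxt_active assms(6) w(1) by blast+
qed

lemma succ_stage_active:
  assumes "wf_state j \<sigma>" "i \<in> {1..n}" "1 \<le> l" "l < p" "Jseq l \<le> j'"
    and "p + 1 - l \<in> active (\<sigma> i)" "active (\<sigma> i) \<subseteq> {p + 1 - l..}" "succ j' \<sigma> \<sigma>'"
  shows "p + 1 - l \<in> active (\<sigma>' i)"
  using succ_nxt[OF assms(8,2)] stage_dominant(2)[OF assms(1-7)] by metis

subsection \<open>Probabilities of prescribed draws\<close>

lemma card_cands_le: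
  assumes "i \<le> n"
  shows "finite (cands j \<sigma> i)" "card (cands j \<sigma> i) \<le> 3"
proof -
  have sub: "cands j \<sigma> i \<subseteq> {i - 1, i + 1, n + 1}"
    using nbrs_subset[OF assms] by (auto simp: cands_def)
  then show "finite (cands j \<sigma> i)" by (rule finite_subset) simp
  have "card (cands j \<sigma> i) \<le> card {i - 1, i + 1, n + 1}" by (rule card_mono[OF _ sub]) simp
  also have "\<dots> \<le> 3" by (simp add: card_insert_if)
  finally show "card (cands j \<sigma> i) \<le> 3" .
qed

lemma draw_prob:
  assumes i: "i \<le> n" and h: "h \<in> cands j \<sigma> i"
  shows "measure_pmf.prob (draw j \<sigma> i) {Some h} \<ge> 1/3"
proof -
  let ?C = "cands j \<sigma> i"
  have ne: "?C \<noteq> {}" using h by auto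
  have "measure_pmf.prob (draw j \<sigma> i) {Some h} = pmf (pmf_of_set ?C) h"
    using ne by (simp add: draw_def measure_pmf_single pmf_map_inj')
  also have "\<dots> = 1 / real (card ?C)" using ne h card_cands_le(1)[OF i] by simp
  also have "\<dots> \<ge> 1/3"
  proof -
    have "card ?C > 0" using ne card_cands_le(1)[OF i] by (simp add: card_gt_0_iff)
    then show ?thesis using card_cands_le(2)[OF i, of j \<sigma>] by (simp add: field_simps)
  qed
  finally show ?thesis .
qed

lemma draw_support: "i \<le> n \<Longrightarrow> ho \<in> set_pmf (draw j \<sigma> i) \<Longrightarrow> ho = None \<or> (\<exists>h\<in>cands j \<sigma> i. ho = Some h)"
  using card_cands_le(1)[of i j \<sigma>] by (auto simp: draw_def split: if_splits)

lemma trans_succ: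
  assumes "\<sigma>' \<in> set_pmf (trans n tbI tbB tbU j \<sigma>)"
  shows "succ j \<sigma> \<sigma>'"
proof -
  obtain Hs where Hs: "Hs \<in> set_pmf (Pi_pmf {1..n} None (draw j \<sigma>))"
    and \<sigma>': "\<sigma>' = (\<lambda>i. if i \<in> {1..n} then nxt j \<sigma> i (Hs i) else \<sigma> i)"
    using assms by (auto simp: trans_eq)
  show ?thesis unfolding succ_def
  proof
    fix i assume i: "i \<in> {1..n}"
    then have "Hs i \<in> set_pmf (draw j \<sigma> i)"
      using Hs by (auto simp: set_Pi_pmf PiE_dflt_def)
    then show "\<sigma>' i = nxt j \<sigma> i None \<or> (\<exists>h\<in>cands j \<sigma> i. \<sigma>' i = nxt j \<sigma> i (Some h))"
      using draw_support i \<sigma>' by force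
  qed
qed

text \<open>Draws of different agents are independent and every agent has at most three candidates.
  Only the agents in \<open>D\<close> are constrained; all others contribute a factor 1.\<close>

lemma trans_prob:
  assumes D: "D \<subseteq> {1..n}" "\<And>i. i \<in> D \<Longrightarrow> f i \<in> cands j \<sigma> i"
    and Q: "\<And>\<sigma>'. succ j \<sigma> \<sigma>' \<Longrightarrow> (\<And>i. i \<in> D \<Longrightarrow> \<sigma>' i = nxt j \<sigma> i (Some (f i))) \<Longrightarrow> Q \<sigma>'"
  shows "measure_pmf.prob (trans n tbI tbB tbU j \<sigma>) {\<sigma>'. Q \<sigma>'} \<ge> (1/3) ^ card D"
proof -
  let ?g = "\<lambda>Hs i. if i \<in> {1..n} then nxt j \<sigma> i (Hs i) else \<sigma> i"
  let ?P = "Pi_pmf {1..n} None (draw j \<sigma>)"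
  define B where "B i = (if i \<in> D then {Some (f i)} else UNIV)" for i
  have "(1/3) ^ card D = (\<Prod>i\<in>{1..n}. if i \<in> D then 1/3 else 1::real)"
    using D(1) by (subst prod.If_cases) (simp_all add: Int_absorb1 Collect_mem_eq)
  also have "\<dots> \<le> (\<Prod>i\<in>{1..n}. measure_pmf.prob (draw j \<sigma> i) (B i))"
    using draw_prob D(2) by (intro prod_mono) (auto simp: B_def)
  also have "\<dots> = measure_pmf.prob ?P (Pi {1..n} B)"
    by (subst measure_Pi_pmf_Pi) auto
  \<comment> \<open>Restriction to the support makes \<open>succ\<close> available for the
    unconstrained agents.\<close>
  also have "\<dots> = measure_pmf.prob ?P (Pi {1..n} B \<inter> set_pmf ?P)"
    by (simp add: measure_Int_set_pmf)
  also have "\<dots> \<le> measure_pmf.prob ?P (?g -` {\<sigma>'. Q \<sigma>'})"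
  proof (rule measure_pmf.finite_measure_mono)
    show "Pi {1..n} B \<inter> set_pmf ?P \<subseteq> ?g -` {\<sigma>'. Q \<sigma>'}"
    proof
      fix Hs assume Hs: "Hs \<in> Pi {1..n} B \<inter> set_pmf ?P"
      have "?g Hs \<in> set_pmf (trans n tbI tbB tbU j \<sigma>)" using Hs by (auto simp: trans_eq)
      then have "succ j \<sigma> (?g Hs)" by (rule trans_succ)
      moreover have "Hs i = Some (f i)" if "i \<in> D" for i
      proof -
        have "Hs i \<in> B i" using Hs D(1) that by auto
        then show ?thesis using that by (simp add: B_def)
      qed
      moreover have "?g Hs i = nxt j \<sigma> i (Hs i)" if "i \<in> D" for i using D(1) that by auto
      ultimately have "Q (?g Hs)" using Q[of "?g Hs"] by simp
      then show "Hs \<in> ?g -` {\<sigma>'. Q \<sigma>'}" by simp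
    qed
  qed simp
  also have "\<dots> = measure_pmf.prob (trans n tbI tbB tbU j \<sigma>) {\<sigma>'. Q \<sigma>'}"
    by (simp only: trans_eq measure_map_pmf)
  finally show ?thesis .
qed

abbreviation sys :: "nat \<Rightarrow> (nat \<Rightarrow> agst) pmf" where
  "sys \<equiv> stp n tbI tbB tbU s u0 l0"

lemma wf_sys: "\<sigma> \<in> set_pmf (sys j) \<Longrightarrow> wf_state j \<sigma>"
proof (induction j arbitrary: \<sigma>)
  case 0
  then show ?case by (simp add: wf_state_def init_st_def rewards_consistent_def)
next
  case (Suc j)
  then obtain \<sigma>0 where "\<sigma>0 \<in> set_pmf (sys j)" "\<sigma> \<in> set_pmf (trans n tbI tbB tbU (Suc j) \<sigma>0)"
    by auto
  then show ?case using wf_succ[OF Suc.IH trans_succ] by blast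
qed

text \<open>The step used for all stage events: prescribing at most \<open>d\<close> draws costs a
  factor \<open>(1/3) ^ d\<close>, and the invariant \<open>wf_state\<close> may be assumed on both
  sides.\<close>

lemma sys_step:
  assumes "measure_pmf.prob (sys j) {\<sigma>. P \<sigma>} \<ge> c" "card (D :: nat set) \<le> d" "D \<subseteq> {1..n}" "0 \<le> c"
    and "\<And>\<sigma> i. wf_state j \<sigma> \<Longrightarrow> P \<sigma> \<Longrightarrow> i \<in> D \<Longrightarrow> f i \<in> cands (Suc j) \<sigma> i"
    and "\<And>\<sigma> \<sigma>'. wf_state j \<sigma> \<Longrightarrow> wf_state (Suc j) \<sigma>' \<Longrightarrow> P \<sigma> \<Longrightarrow> succ (Suc j) \<sigma> \<sigma>' \<Longrightarrow>
          (\<And>i. i \<in> D \<Longrightarrow> \<sigma>' i = nxt (Suc j) \<sigma> i (Some (f i))) \<Longrightarrow> Q \<sigma>'"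
  shows "measure_pmf.prob (sys (Suc j)) {\<sigma>. Q \<sigma>} \<ge> c * (1/3) ^ d"
proof -
  have "c * (1/3) ^ d \<le> c * (1/3) ^ card D"
    using assms by (intro mult_left_mono power_decreasing) auto
  also have "\<dots> \<le> measure_pmf.prob (bind_pmf (sys j) (trans n tbI tbB tbU (Suc j))) {\<sigma>. Q \<sigma>}"
  proof (rule prob_bind_ge[OF assms(1)])
    fix \<sigma> assume \<sigma>: "\<sigma> \<in> set_pmf (sys j)" "P \<sigma>"
    note wf = wf_sys[OF \<sigma>(1)]
    show "(1/3) ^ card D \<le> measure_pmf.prob (trans n tbI tbB tbU (Suc j) \<sigma>) {\<sigma>. Q \<sigma>}"
    proof (rule trans_prob[OF assms(3)])
      show "f i \<in> cands (Suc j) \<sigma> i" if "i \<in> D" for i by (rule assms(5)[OF wf \<sigma>(2) that])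
      show "Q \<sigma>'" if "succ (Suc j) \<sigma> \<sigma>'" "\<And>i. i \<in> D \<Longrightarrow> \<sigma>' i = nxt (Suc j) \<sigma> i (Some (f i))" for \<sigma>'
        by (rule assms(6)[OF wf wf_succ[OF wf that(1)] \<sigma>(2) that])
    qed
  qed simp
  finally show ?thesis by simp
qed


section \<open>The blocking cascade\<close>

lemma scheduled_ge: "scheduled j i \<Longrightarrow> 256 \<le> j"
  using Jseq_ge_256 by (auto simp: scheduled_def)

lemma unscheduled_between:
  assumes "Jseq l < j" "j < Jseq (Suc l)"
  shows "\<not> scheduled j i"
proof
  assume "scheduled j i"
  then obtain l' where "j = Jseq l'" by (auto simp: scheduled_def)
  then have "l < l'" "l' < Suc l" using assms strict_mono_less[OF strict_mono_Jseq] by auto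
  then show False by simp
qed

lemma unscheduled_right:
  assumes "j = Jseq l" "l + 2 + p < i"
  shows "\<not> scheduled j i"
  using assms by (auto simp: scheduled_def)

text \<open>On the line, honest neighbours of agents right of \<open>q\<close> lie in
  \<open>{q..n}\<close>, and off schedule the malicious agent brings in no new arm. Agent
  \<open>q\<close> itself is excluded from the conclusion, as its left neighbour is
  uncontrolled.\<close>

lemma active_step:
  assumes succ: "succ j \<sigma> \<sigma>'" and A: "\<And>h. h \<in> {q..n} \<Longrightarrow> active (\<sigma> h) \<subseteq> A"
    and i: "i \<in> {q + 1..n}" and unsch: "\<not> scheduled j i"
  shows "active (\<sigma>' i) \<subseteq> A"
proof (rule succ_active[OF succ])
  show "i \<in> {1..n}" "active (\<sigma> i) \<subseteq> A" using i A[of i] by auto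
  fix h assume h: "h \<in> cands j \<sigma> i"
  show "recm j \<sigma> i h \<in> A"
  proof (cases "h \<le> n")
    case True
    note r = recm_honest[OF h True]
    have "h \<in> {q..n}" using r(3) i True by auto
    then show ?thesis using A r(1) i by auto
  next
    case False
    then show ?thesis using recm_mal[OF unsch False] A[of i] i by auto
  qed
qed

text \<open>The situation before phase 256. The agents \<open>p + 2\<close> to \<open>p + 4\<close>
  are those with prescribed draws in the first stage; having listened to the malicious agent only,
  they have empty blocklists.\<close>

definition base :: "nat \<Rightarrow> (nat \<Rightarrow> agst) \<Rightarrow> bool" where
  "base j \<sigma> \<longleftrightarrow> (\<forall>i\<in>{p + 2..n}. active (\<sigma> i) \<subseteq> {p + 1..} \<and> malsafe j \<sigma> i \<and>
     (i \<le> p + 4 \<longrightarrow> (\<forall>h. blk (\<sigma> i) h = 0) \<and> (\<forall>h r. prv (\<sigma> i) = Some (h, r) \<longrightarrow> h = n + 1)))"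

text \<open>Stage \<open>l\<close> concerns the agents \<open>q = p + l + 1\<close>, \<open>q + 1\<close>, \<open>q + 2\<close> and the arm \<open>p + 1 - l\<close>
  that the malicious agent releases at phase \<open>J\<^sub>l\<close>: \<open>armed\<close> holds after the draws of phase \<open>J\<^sub>l\<close>,
  \<open>passed\<close> one phase later, and \<open>shielded\<close>, with \<open>l\<close> increased by one, from then on until the draws
  of phase \<open>J\<^bsub>l+1\<^esub>\<close>.\<close>

definition armed :: "nat \<Rightarrow> (nat \<Rightarrow> agst) \<Rightarrow> bool" where
  "armed l \<sigma> \<longleftrightarrow> (let q = p + l + 1; a = p + 1 - l in
     active (\<sigma> q) \<subseteq> {a + 1..} \<and> (\<forall>i\<in>{q + 1..n}. active (\<sigma> i) \<subseteq> {a..}) \<and>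
     (\<forall>i\<in>{q + 2..n}. malsafe (Jseq l) \<sigma> i) \<and>
     a \<in> active (\<sigma> (q + 1)) \<and> prv (\<sigma> (q + 1)) = Some (n + 1, a) \<and> blk (\<sigma> (q + 1)) q \<le> Jseq l \<and>
     (q + 2 \<le> n \<longrightarrow> blk (\<sigma> (q + 2)) (q + 1) \<le> Jseq l \<and>
        (\<forall>r. prv (\<sigma> (q + 2)) = Some (q + 1, r) \<longrightarrow> r = best (Suc (Jseq l)) \<sigma> (q + 2))))"

definition passed :: "nat \<Rightarrow> (nat \<Rightarrow> agst) \<Rightarrow> bool" where
  "passed l \<sigma> \<longleftrightarrow> (let q = p + l + 1; a = p + 1 - l in
     (\<forall>i\<in>{q + 1..n}. active (\<sigma> i) \<subseteq> {a..}) \<and> (\<forall>i\<in>{q + 2..n}. malsafe (Suc (Jseq l)) \<sigma> i) \<and>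
     a \<in> active (\<sigma> (q + 1)) \<and> (\<exists>r. prv (\<sigma> (q + 1)) = Some (q, r) \<and> r \<noteq> a) \<and>
     (q + 2 \<le> n \<longrightarrow> a \<in> active (\<sigma> (q + 2)) \<and> prv (\<sigma> (q + 2)) = Some (q + 1, a)))"

definition shielded :: "nat \<Rightarrow> nat \<Rightarrow> (nat \<Rightarrow> agst) \<Rightarrow> bool" where
  "shielded l j \<sigma> \<longleftrightarrow> (let q = p + l + 1; a = p + 2 - l in
     (\<forall>i\<in>{q..n}. active (\<sigma> i) \<subseteq> {a..}) \<and> (\<forall>i\<in>{q + 1..n}. malsafe j \<sigma> i) \<and>
     Jseq l \<le> blk (\<sigma> q) (q - 1) \<and> a \<in> active (\<sigma> q) \<and>
     (q + 1 \<le> n \<longrightarrow> a \<in> active (\<sigma> (q + 1)) \<and> blk (\<sigma> q) (q + 1) < Jseq l \<and>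
        blk (\<sigma> (q + 1)) q < Jseq l \<and> (\<forall>r. prv (\<sigma> q) = Some (q + 1, r) \<longrightarrow> r = a) \<and>
        (\<forall>r. prv (\<sigma> (q + 1)) = Some (q, r) \<longrightarrow> r = a)) \<and>
     (q + 2 \<le> n \<longrightarrow> blk (\<sigma> (q + 2)) (q + 1) \<le> Jseq l \<and>
        (\<forall>r. prv (\<sigma> (q + 2)) = Some (q + 1, r) \<longrightarrow> r = a)))"

section \<open>From the initial state to the first release\<close>

lemma base_init: "base 0 (init_st s u0 l0)"
  using init_right unfolding base_def malsafe_def
  by (auto simp: init_st_def active_def Suc_le_eq)

lemma base_step:
  assumes b: "base j \<sigma>" and succ: "succ (Suc j) \<sigma> \<sigma>'" and j: "Suc j < 256"
    and f: "\<And>i. i \<in> {p + 2..n} \<Longrightarrow> i \<le> p + 4 \<Longrightarrow> \<sigma>' i = nxt (Suc j) \<sigma> i (Some (n + 1))"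
  shows "base (Suc j) \<sigma>'"
  unfolding base_def
proof (intro ballI conjI impI allI)
  fix i assume i: "i \<in> {p + 2..n}"
  have i1: "i \<in> {1..n}" using i by auto
  have b': "\<And>i. i \<in> {p + 2..n} \<Longrightarrow> active (\<sigma> i) \<subseteq> {p + 1..}" "malsafe j \<sigma> i"
    "i \<le> p + 4 \<Longrightarrow> blk (\<sigma> i) h = 0" "i \<le> p + 4 \<Longrightarrow> prv (\<sigma> i) = Some (h, r) \<Longrightarrow> h = n + 1" for h r
    using b i by (auto simp: base_def)
  have u: "\<not> scheduled (Suc j) i" using scheduled_ge j by force
  show "malsafe (Suc j) \<sigma>' i" by (rule malsafe_succ[OF b'(2) succ i1 u])
  show "active (\<sigma>' i) \<subseteq> {p + 1..}"
  \<comment> \<open>Agent \<open>p + 1\<close> may hold good arms, so agent \<open>p + 2\<close> is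
    protected only by its prescribed draw; for the agents further right the line structure
    suffices.\<close>
  proof (cases "i = p + 2")
    case True
    have "recm (Suc j) \<sigma> i (n + 1) \<in> active (\<sigma> i)" using recm_mal[OF u] by simp
    then show ?thesis using nxt_Some_old(3) f[OF i] b'(1)[OF i] True by simp
  next
    case False
    show ?thesis by (rule active_step[OF succ, of "p + 2"]) (use b'(1) i False u in auto)
  qed
  assume i4: "i \<le> p + 4"
  show "h = n + 1" if "prv (\<sigma>' i) = Some (h, r)" for h r
    using that f[OF i i4] by simp
  fix h
  have "blk (blocked (Suc j) \<sigma> i) h = blk (\<sigma> i) h"
    using b'(2,4) i4 by (intro blk_blocked_unchanged) (auto simp: malsafe_def)
  then show "blk (\<sigma>' i) h = 0" using succ_blk[OF succ i1] b'(3)[OF i4] by simp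
qed

lemma prob_base: "j < 256 \<Longrightarrow> measure_pmf.prob (sys j) {\<sigma>. base j \<sigma>} \<ge> (1/27) ^ j"
proof (induction j)
  case 0
  then show ?case using base_init by simp
next
  case (Suc j)
  let ?D = "{p + 2, p + 3, p + 4} \<inter> {..n}"
  have "measure_pmf.prob (sys (Suc j)) {\<sigma>. base (Suc j) \<sigma>} \<ge> (1/27) ^ j * (1/3) ^ 3"
  proof (rule sys_step[where D = ?D and f = "\<lambda>_. n + 1" and P = "base j"])
    have "card ?D \<le> card {p + 2, p + 3, p + 4}" by (rule card_mono) auto
    then show "card ?D \<le> 3" by simp
    show "n + 1 \<in> cands (Suc j) \<sigma> i" if "base j \<sigma>" "i \<in> ?D" for \<sigma> i
      using that by (intro malsafe_cands) (auto simp: base_def)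
    show "base (Suc j) \<sigma>'"
      if "base j \<sigma>" "succ (Suc j) \<sigma> \<sigma>'" "\<And>i. i \<in> ?D \<Longrightarrow> \<sigma>' i = nxt (Suc j) \<sigma> i (Some (n + 1))" for \<sigma> \<sigma>'
    proof (rule base_step[OF that(1,2) Suc.prems])
      fix i assume "i \<in> {p + 2..n}" "i \<le> p + 4"
      then have "i \<in> ?D" by auto
      then show "\<sigma>' i = nxt (Suc j) \<sigma> i (Some (n + 1))" by (rule that(3))
    qed
  qed (use Suc in auto)
  then show ?case by (simp add: power_divide)
qed

text \<open>The draws of phase \<open>Jseq l\<close>, shared by the first stage and all later ones.
  Agent \<open>p + l + 1\<close> is also on the schedule but draws its right neighbour, so it does
  not get the released arm; agent \<open>p + l + 2\<close> draws the malicious agent and gets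
  it.\<close>

lemma arm_step:
  assumes l: "1 \<le> l" "l + 2 \<le> p" and j: "Suc j = Jseq l"
    and A: "\<And>i. i \<in> {p + l + 1..n} \<Longrightarrow> active (\<sigma> i) \<subseteq> {p + 2 - l..}"
    and safe: "\<And>i. i \<in> {p + l + 2..n} \<Longrightarrow> malsafe j \<sigma> i"
    and succ: "succ (Suc j) \<sigma> \<sigma>'"
    and f: "\<sigma>' (p + l + 1) = nxt (Suc j) \<sigma> (p + l + 1) (Some (p + l + 2))"
      "\<sigma>' (p + l + 2) = nxt (Suc j) \<sigma> (p + l + 2) (Some (n + 1))"
    and blk: "blk (\<sigma>' (p + l + 2)) (p + l + 1) \<le> Jseq l"
    and last: "p + l + 3 \<le> n \<Longrightarrow> blk (\<sigma>' (p + l + 3)) (p + l + 2) \<le> Jseq l \<and>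
        (\<forall>r. prv (\<sigma>' (p + l + 3)) = Some (p + l + 2, r) \<longrightarrow> r = best (Suc (Jseq l)) \<sigma>' (p + l + 3))"
  shows "armed l \<sigma>'"
proof -
  have ln: "p + l + 2 \<le> n" using l n_eq by simp
  have mal: "recm (Suc j) \<sigma> (p + l + 2) (n + 1) = p + 1 - l"
    using mal_rec_scheduled[of l "p + l + 2"] l by (simp add: recm_def j)
  have "recm (Suc j) \<sigma> (p + l + 1) (p + l + 2) \<in> active (\<sigma> (p + l + 2))"
    using best_active ln by (simp add: recm_def)
  then have 1: "active (\<sigma>' (p + l + 1)) \<subseteq> {p + 2 - l..}"
    unfolding f(1) using nxt_Some_active[of "Suc j" \<sigma> "p + l + 1" "p + l + 2"] A[of "p + l + 1"] A[of "p + l + 2"] ln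
    by auto
  have 2: "active (\<sigma>' i) \<subseteq> {p + 1 - l..}" if i: "i \<in> {p + l + 2..n}" for i
  proof (cases "i = p + l + 2")
    case True
    have "active (\<sigma> (p + l + 2)) \<subseteq> {p + 2 - l..}" using A[of "p + l + 2"] ln by simp
    also have "\<dots> \<subseteq> {p + 1 - l..}" by auto
    finally show ?thesis
      unfolding True f(2) using nxt_Some_active[of "Suc j" \<sigma> "p + l + 2" "n + 1"] mal by auto
  next
    case False
    have "active (\<sigma>' i) \<subseteq> {p + 2 - l..}"
      by (rule active_step[OF succ, of "p + l + 1"]) (use A i False unscheduled_right[OF j] in auto)
    then show ?thesis by auto
  qed
  have 3: "malsafe (Jseq l) \<sigma>' i" if i: "i \<in> {p + l + 3..n}" for i
    unfolding j[symmetric]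
    by (rule malsafe_succ[OF safe succ]) (use i unscheduled_right[OF j] in auto)
  have 4: "p + 1 - l \<in> active (\<sigma>' (p + l + 2))"
    unfolding f(2) using recm_nxt_active[of "Suc j" \<sigma> "p + l + 2" "n + 1"] mal by simp
  have 5: "prv (\<sigma>' (p + l + 2)) = Some (n + 1, p + 1 - l)"
    unfolding f(2) using mal by simp
  have e: "p + l + 1 + 1 = p + l + 2" "p + l + 1 + 2 = p + l + 3" "p + 1 - l + 1 = p + 2 - l"
    using l by auto
  show ?thesis unfolding armed_def Let_def e
    using 1 2 3 4 5 blk last by blast
qed

lemma base_armed:
  assumes p: "3 \<le> p" and b: "base 255 \<sigma>" and succ: "succ 256 \<sigma> \<sigma>'"
    and f: "\<sigma>' (p + 2) = nxt 256 \<sigma> (p + 2) (Some (p + 3))"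
      "\<sigma>' (p + 3) = nxt 256 \<sigma> (p + 3) (Some (n + 1))"
      "p + 4 \<le> n \<Longrightarrow> \<sigma>' (p + 4) = nxt 256 \<sigma> (p + 4) (Some (n + 1))"
  shows "armed 1 \<sigma>'"
proof -
  have b': "active (\<sigma> i) \<subseteq> {p + 1..}" "malsafe 255 \<sigma> i"
    "i \<le> p + 4 \<Longrightarrow> blk (\<sigma> i) h = 0" "i \<le> p + 4 \<Longrightarrow> prv (\<sigma> i) = Some (h, r) \<Longrightarrow> h = n + 1"
    if "i \<in> {p + 2..n}" for i h r
    using b that by (auto simp: base_def)
  \<comment> \<open>Any last recommendation of these agents came from the malicious agent and is
    played most, so phase 256 blocks nobody for them.\<close>
  have z: "blk (\<sigma>' i) h = 0" if i: "i \<in> {p + 2..n}" "i \<le> p + 4" for i h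
  proof -
    have "best 256 \<sigma> i = r" if pr: "prv (\<sigma> i) = Some (h, r)" for r
      using b'(4)[OF i pr] b'(2)[OF i(1)] pr by (simp add: malsafe_def)
    then have "blk (blocked 256 \<sigma> i) h = blk (\<sigma> i) h" by (rule blk_blocked_unchanged)
    then show ?thesis using succ_blk[OF succ, of i] b'(3)[OF i] i by simp
  qed
  have e: "p + 1 + 1 = p + 2" "p + 1 + 2 = p + 3" "p + 1 + 3 = p + 4" "p + 2 - 1 = p + 1" "Suc 255 = 256"
    by auto
  have n6: "p + 3 \<le> n" using p n_eq by simp
  show ?thesis
  proof (rule arm_step[of 1 255 \<sigma> \<sigma>', unfolded e])
    show "blk (\<sigma>' (p + 4)) (p + 3) \<le> Jseq 1 \<and>
        (\<forall>r. prv (\<sigma>' (p + 4)) = Some (p + 3, r) \<longrightarrow> r = best (Suc (Jseq 1)) \<sigma>' (p + 4))"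
      if "p + 4 \<le> n"
      using z[of "p + 4" "p + 3"] f(3)[OF that] that by simp
    show "blk (\<sigma>' (p + 3)) (p + 2) \<le> Jseq 1" using z[of "p + 3" "p + 2"] n6 by simp
  qed (use p succ f(1,2) b'(1,2) in auto)
qed

text \<open>Old blocks reach at most phase \<open>Jseq l\<close> and have expired one phase later.
  No new one arises: the last recommendation to \<open>p + l + 2\<close> came from the malicious
  agent, and one from \<open>p + l + 2\<close> to \<open>p + l + 3\<close> would agree with the most
  played arm.\<close>

lemma armed_cands:
  assumes a: "armed l \<sigma>" and l: "1 \<le> l" "l + 2 \<le> p"
  shows "p + l + 1 \<in> cands (Suc (Jseq l)) \<sigma> (p + l + 2)"
    and "p + l + 3 \<le> n \<Longrightarrow> p + l + 2 \<in> cands (Suc (Jseq l)) \<sigma> (p + l + 3)"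
proof -
  have ln: "p + l + 2 \<le> n" using l n_eq by simp
  have a': "prv (\<sigma> (p + l + 2)) = Some (n + 1, p + 1 - l)" "blk (\<sigma> (p + l + 2)) (p + l + 1) \<le> Jseq l"
    "p + l + 3 \<le> n \<Longrightarrow> blk (\<sigma> (p + l + 3)) (p + l + 2) \<le> Jseq l"
    "p + l + 3 \<le> n \<Longrightarrow> prv (\<sigma> (p + l + 3)) = Some (p + l + 2, r) \<Longrightarrow> r = best (Suc (Jseq l)) \<sigma> (p + l + 3)" for r
    using a by (auto simp: armed_def Let_def numeral_eq_Suc)
  have "blk (blocked (Suc (Jseq l)) \<sigma> (p + l + 2)) (p + l + 1) = blk (\<sigma> (p + l + 2)) (p + l + 1)"
    by (rule blk_blocked_unchanged) (use a'(1) ln in auto)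
  then show "p + l + 1 \<in> cands (Suc (Jseq l)) \<sigma> (p + l + 2)"
    using a'(2) nbrs_mem(2)[of "p + l + 2" n] ln by (simp add: cands_def)
  assume ln3: "p + l + 3 \<le> n"
  have "blk (blocked (Suc (Jseq l)) \<sigma> (p + l + 3)) (p + l + 2) = blk (\<sigma> (p + l + 3)) (p + l + 2)"
    by (rule blk_blocked_unchanged) (use a'(4) ln3 in auto)
  then show "p + l + 2 \<in> cands (Suc (Jseq l)) \<sigma> (p + l + 3)"
    using a'(3)[OF ln3] nbrs_mem(2)[of "p + l + 3" n] ln3 by (simp add: cands_def numeral_eq_Suc)
qed

lemma armed_passed:
  assumes a: "armed l \<sigma>" and wf: "wf_state (Jseq l) \<sigma>" and l: "1 \<le> l" "l + 2 \<le> p"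
    and succ: "succ (Suc (Jseq l)) \<sigma> \<sigma>'"
    and f: "\<sigma>' (p + l + 2) = nxt (Suc (Jseq l)) \<sigma> (p + l + 2) (Some (p + l + 1))"
      "p + l + 3 \<le> n \<Longrightarrow> \<sigma>' (p + l + 3) = nxt (Suc (Jseq l)) \<sigma> (p + l + 3) (Some (p + l + 2))"
  shows "passed l \<sigma>'"
proof -
  have ln: "p + l + 2 \<le> n" using l n_eq by simp
  have e: "p + l + 1 + 1 = p + l + 2" "p + l + 1 + 2 = p + l + 3" "p + 1 - l + 1 = p + 2 - l"
    using l by auto
  have a': "active (\<sigma> (p + l + 1)) \<subseteq> {p + 2 - l..}"
    "\<And>i. i \<in> {p + l + 2..n} \<Longrightarrow> active (\<sigma> i) \<subseteq> {p + 1 - l..}"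
    "\<And>i. i \<in> {p + l + 3..n} \<Longrightarrow> malsafe (Jseq l) \<sigma> i" "p + 1 - l \<in> active (\<sigma> (p + l + 2))"
    using a unfolding armed_def Let_def e by auto
  have u: "\<not> scheduled (Suc (Jseq l)) i" for i
    by (rule unscheduled_between[of l]) (use l in \<open>auto simp: Jseq_Suc power2_eq_square\<close>)
  have A: "active (\<sigma> i) \<subseteq> {p + 1 - l..}" if "i \<in> {p + l + 1..n}" for i
    using a'(1) a'(2)[of i] that by (cases "i = p + l + 1") auto
  have 1: "active (\<sigma>' i) \<subseteq> {p + 1 - l..}" if "i \<in> {p + l + 2..n}" for i
    by (rule active_step[OF succ, of "p + l + 1"]) (use A u that in auto)
  have 2: "malsafe (Suc (Jseq l)) \<sigma>' i" if "i \<in> {p + l + 3..n}" for i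
    by (rule malsafe_succ[OF a'(3) succ]) (use that u in auto)
  have in2: "p + l + 2 \<in> {1..n}" using ln by auto
  have 3: "p + 1 - l \<in> active (\<sigma>' (p + l + 2))"
    by (rule succ_stage_active[OF wf in2 _ _ _ a'(4) _ succ]) (use l ln a'(2) in auto)
  \<comment> \<open>The sender does not hold the released arm, so its recommendation must differ
    from it; this mismatch causes the block in the next phase.\<close>
  have "best (Suc (Jseq l)) \<sigma> (p + l + 1) \<in> {p + 2 - l..}" using best_active a'(1) by auto
  then have 4: "\<exists>r. prv (\<sigma>' (p + l + 2)) = Some (p + l + 1, r) \<and> r \<noteq> p + 1 - l"
    unfolding f(1) using ln l by (auto simp: recm_def)
  have B: "best (Suc (Jseq l)) \<sigma> (p + l + 2) = p + 1 - l"
    by (rule stage_dominant(1)[OF wf in2]) (use l ln a'(2,4) in auto)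
  have 5: "p + 1 - l \<in> active (\<sigma>' (p + l + 3)) \<and> prv (\<sigma>' (p + l + 3)) = Some (p + l + 2, p + 1 - l)"
    if "p + l + 3 \<le> n"
    unfolding f(2)[OF that]
    using recm_nxt_active[of "Suc (Jseq l)" \<sigma> "p + l + 3" "p + l + 2"] B ln by (simp add: recm_def)
  show ?thesis unfolding passed_def Let_def e using 1 2 3 4 5 by blast
qed

text \<open>Serves both to enter and to maintain the shielded state. With its left neighbour
  blocked, agent \<open>p + l + 1\<close> can hear only its right neighbour and the malicious agent,
  so no arm below \<open>p + 2 - l\<close> passes. Blocks are taken after the blocking rule of phase
  \<open>Suc j\<close>, which is when the draws take place.\<close>

lemma shielded_intro:
  assumes wf: "wf_state j \<sigma>" and l: "2 \<le> l" "l < p" and j: "Jseq (l - 1) < Suc j" "Suc j < Jseq l"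
    and A: "\<And>i. i \<in> {p + l + 1..n} \<Longrightarrow> active (\<sigma> i) \<subseteq> {p + 2 - l..}"
    and safe: "\<And>i. i \<in> {p + l + 2..n} \<Longrightarrow> malsafe j \<sigma> i"
    and b: "Jseq l \<le> blk (blocked (Suc j) \<sigma> (p + l + 1)) (p + l)"
    and a: "p + 2 - l \<in> active (\<sigma> (p + l + 1))"
    and a2: "p + l + 2 \<le> n \<Longrightarrow> p + 2 - l \<in> active (\<sigma> (p + l + 2))"
    and b2: "p + l + 2 \<le> n \<Longrightarrow> blk (blocked (Suc j) \<sigma> (p + l + 1)) (p + l + 2) < Jseq l"
      "p + l + 2 \<le> n \<Longrightarrow> blk (blocked (Suc j) \<sigma> (p + l + 2)) (p + l + 1) < Jseq l"
    and b3: "p + l + 3 \<le> n \<Longrightarrow> blk (blocked (Suc j) \<sigma> (p + l + 3)) (p + l + 2) \<le> Jseq l"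
    and succ: "succ (Suc j) \<sigma> \<sigma>'"
  shows "shielded l (Suc j) \<sigma>'"
proof -
  have ln: "p + l + 1 \<le> n" using l n_eq by simp
  have in1: "p + l + 1 \<in> {1..n}" using ln by auto
  have u: "\<not> scheduled (Suc j) i" for i
    by (rule unscheduled_between[of "l - 1"]) (use j l in auto)
  have el: "p + 1 - (l - 1) = p + 2 - l" using l by auto
  have dom: "best (Suc j) \<sigma> i = p + 2 - l" "p + 2 - l \<in> active (\<sigma>' i)"
    if i: "i \<in> {p + l + 1..n}" "p + 2 - l \<in> active (\<sigma> i)" for i
  proof -
    have i1: "i \<in> {1..n}" using i by auto
    show "best (Suc j) \<sigma> i = p + 2 - l"
      by (rule stage_dominant(1)[OF wf i1, of "l - 1", unfolded el]) (use l j A i in auto)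
    show "p + 2 - l \<in> active (\<sigma>' i)"
      by (rule succ_stage_active[OF wf i1, of "l - 1", unfolded el, OF _ _ _ _ _ succ]) (use l j A i in auto)
  qed
  have 1: "active (\<sigma>' i) \<subseteq> {p + 2 - l..}" if i: "i \<in> {p + l + 1..n}" for i
  proof (cases "i = p + l + 1")
    case True
    show ?thesis
    proof (rule succ_active[OF succ])
      show "i \<in> {1..n}" "active (\<sigma> i) \<subseteq> {p + 2 - l..}" using i A[OF i] by auto
      fix h assume h: "h \<in> cands (Suc j) \<sigma> i"
      show "recm (Suc j) \<sigma> i h \<in> {p + 2 - l..}"
      proof (cases "h \<le> n")
        case hn: True
        note r = recm_honest[OF h hn]
        \<comment> \<open>The block on the left neighbour lasts until \<open>Jseq l\<close>, beyond
          phase \<open>Suc j\<close>.\<close>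
        have "h \<noteq> p + l" using h b j True by (auto simp: cands_def)
        then have "h \<in> {p + l + 1..n}" using r(3) i hn True by auto
        then show ?thesis using A r(1) i by auto
      next
        case False
        then show ?thesis using recm_mal[OF u False] A[OF i] by auto
      qed
    qed
  next
    case False
    show ?thesis by (rule active_step[OF succ, of "p + l + 1"]) (use A i False u in auto)
  qed
  have 2: "malsafe (Suc j) \<sigma>' i" if "i \<in> {p + l + 2..n}" for i
    by (rule malsafe_succ[OF safe succ]) (use that u in auto)
  have bl: "blk (\<sigma>' i) = blk (blocked (Suc j) \<sigma> i)" if "i \<in> {p + l + 1..n}" for i
    using succ_blk[OF succ, of i] that by auto
  have pr: "r = p + 2 - l"
    if "prv (\<sigma>' i) = Some (h, r)" "i \<in> {p + l + 1..n}" "h \<in> {p + l + 1..n}" "p + 2 - l \<in> active (\<sigma> h)" for i h r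
    using succ_prv(2)[OF succ _ that(1)] that(2,3) dom(1)[OF that(3,4)] by (auto simp: recm_def)
  have 3: "Jseq l \<le> blk (\<sigma>' (p + l + 1)) (p + l)" using bl[of "p + l + 1"] b ln by simp
  have 4: "p + 2 - l \<in> active (\<sigma>' (p + l + 1))" using dom(2) a ln by simp
  have 5: "p + 2 - l \<in> active (\<sigma>' (p + l + 2)) \<and> blk (\<sigma>' (p + l + 1)) (p + l + 2) < Jseq l \<and>
        blk (\<sigma>' (p + l + 2)) (p + l + 1) < Jseq l \<and>
        (\<forall>r. prv (\<sigma>' (p + l + 1)) = Some (p + l + 2, r) \<longrightarrow> r = p + 2 - l) \<and>
        (\<forall>r. prv (\<sigma>' (p + l + 2)) = Some (p + l + 1, r) \<longrightarrow> r = p + 2 - l)" if h: "p + l + 2 \<le> n"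
    using dom(2)[of "p + l + 2"] a2[OF h] a b2[OF h] h bl[of "p + l + 1"] bl[of "p + l + 2"]
      pr[of "p + l + 1" "p + l + 2"] pr[of "p + l + 2" "p + l + 1"] by simp
  have 6: "blk (\<sigma>' (p + l + 3)) (p + l + 2) \<le> Jseq l \<and>
        (\<forall>r. prv (\<sigma>' (p + l + 3)) = Some (p + l + 2, r) \<longrightarrow> r = p + 2 - l)" if h: "p + l + 3 \<le> n"
    using a2 b3[OF h] h bl[of "p + l + 3"] pr[of "p + l + 3" "p + l + 2"] by simp
  have e: "p + l + 1 + 1 = p + l + 2" "p + l + 1 + 2 = p + l + 3" "p + l + 1 - 1 = p + l"
    using l by auto
  show ?thesis unfolding shielded_def Let_def e using 1 2 3 4 5 6 by blast
qed

lemma shieldedD: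
  assumes "shielded l j \<sigma>"
  shows "\<And>i. i \<in> {p + l + 1..n} \<Longrightarrow> active (\<sigma> i) \<subseteq> {p + 2 - l..}"
    and "\<And>i. i \<in> {p + l + 2..n} \<Longrightarrow> malsafe j \<sigma> i"
    and "Jseq l \<le> blk (\<sigma> (p + l + 1)) (p + l)"
    and "p + 2 - l \<in> active (\<sigma> (p + l + 1))"
    and "p + l + 2 \<le> n \<Longrightarrow> p + 2 - l \<in> active (\<sigma> (p + l + 2))"
    and "p + l + 2 \<le> n \<Longrightarrow> blk (\<sigma> (p + l + 1)) (p + l + 2) < Jseq l"
    and "p + l + 2 \<le> n \<Longrightarrow> blk (\<sigma> (p + l + 2)) (p + l + 1) < Jseq l"
    and "\<And>r. p + l + 2 \<le> n \<Longrightarrow> prv (\<sigma> (p + l + 1)) = Some (p + l + 2, r) \<Longrightarrow> r = p + 2 - l"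
    and "\<And>r. p + l + 2 \<le> n \<Longrightarrow> prv (\<sigma> (p + l + 2)) = Some (p + l + 1, r) \<Longrightarrow> r = p + 2 - l"
    and "p + l + 3 \<le> n \<Longrightarrow> blk (\<sigma> (p + l + 3)) (p + l + 2) \<le> Jseq l"
    and "\<And>r. p + l + 3 \<le> n \<Longrightarrow> prv (\<sigma> (p + l + 3)) = Some (p + l + 2, r) \<Longrightarrow> r = p + 2 - l"
proof -
  have e: "p + l + 1 + 1 = p + l + 2" "p + l + 1 + 2 = p + l + 3" "p + l + 1 - 1 = p + l"
    by auto
  note d = assms[unfolded shielded_def Let_def e]
  show "\<And>i. i \<in> {p + l + 1..n} \<Longrightarrow> active (\<sigma> i) \<subseteq> {p + 2 - l..}"
    "\<And>i. i \<in> {p + l + 2..n} \<Longrightarrow> malsafe j \<sigma> i"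
    "Jseq l \<le> blk (\<sigma> (p + l + 1)) (p + l)"
    "p + 2 - l \<in> active (\<sigma> (p + l + 1))"
    "p + l + 2 \<le> n \<Longrightarrow> p + 2 - l \<in> active (\<sigma> (p + l + 2))"
    "p + l + 2 \<le> n \<Longrightarrow> blk (\<sigma> (p + l + 1)) (p + l + 2) < Jseq l"
    "p + l + 2 \<le> n \<Longrightarrow> blk (\<sigma> (p + l + 2)) (p + l + 1) < Jseq l"
    "\<And>r. p + l + 2 \<le> n \<Longrightarrow> prv (\<sigma> (p + l + 1)) = Some (p + l + 2, r) \<Longrightarrow> r = p + 2 - l"
    "\<And>r. p + l + 2 \<le> n \<Longrightarrow> prv (\<sigma> (p + l + 2)) = Some (p + l + 1, r) \<Longrightarrow> r = p + 2 - l"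
    "p + l + 3 \<le> n \<Longrightarrow> blk (\<sigma> (p + l + 3)) (p + l + 2) \<le> Jseq l"
    "\<And>r. p + l + 3 \<le> n \<Longrightarrow> prv (\<sigma> (p + l + 3)) = Some (p + l + 2, r) \<Longrightarrow> r = p + 2 - l"
    using d by blast+
qed

text \<open>Every agent in range that holds arm \<open>p + 2 - l\<close> plays it most, so
  recommendations of this arm trigger no block. The strict bound for \<open>p + l + 1\<close> is
  needed because it must be able to draw \<open>p + l + 2\<close> in phase \<open>Jseq l\<close>
  itself.\<close>

lemma shielded_blocked:
  assumes sh: "shielded l j \<sigma>" and wf: "wf_state j \<sigma>" and l: "2 \<le> l" "l < p" and j: "Jseq (l - 1) \<le> j"
  shows "p + l + 2 \<le> n \<Longrightarrow> blk (blocked (Suc j) \<sigma> (p + l + 1)) (p + l + 2) < Jseq l"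
    and "p + l + 2 \<le> n \<Longrightarrow> blk (blocked (Suc j) \<sigma> (p + l + 2)) (p + l + 1) < Jseq l"
    and "p + l + 3 \<le> n \<Longrightarrow> blk (blocked (Suc j) \<sigma> (p + l + 3)) (p + l + 2) \<le> Jseq l"
    and "\<And>i. i \<in> {p + l + 1..n} \<Longrightarrow> p + 2 - l \<in> active (\<sigma> i) \<Longrightarrow> best (Suc j) \<sigma> i = p + 2 - l"
proof -
  note d = shieldedD[OF sh]
  have el: "p + 1 - (l - 1) = p + 2 - l" using l by auto
  show dom: "best (Suc j) \<sigma> i = p + 2 - l" if i: "i \<in> {p + l + 1..n}" "p + 2 - l \<in> active (\<sigma> i)" for i
  proof -
    have i1: "i \<in> {1..n}" using i by auto
    show ?thesis
      by (rule stage_dominant(1)[OF wf i1, of "l - 1", unfolded el]) (use l j d(1) i in auto)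
  qed
  show "blk (blocked (Suc j) \<sigma> (p + l + 1)) (p + l + 2) < Jseq l" if h: "p + l + 2 \<le> n"
    using blk_blocked_unchanged[of \<sigma> "p + l + 1" "p + l + 2" "Suc j"] d(8)[OF h] d(6)[OF h]
      dom[of "p + l + 1"] d(4) h by auto
  show "blk (blocked (Suc j) \<sigma> (p + l + 2)) (p + l + 1) < Jseq l" if h: "p + l + 2 \<le> n"
    using blk_blocked_unchanged[of \<sigma> "p + l + 2" "p + l + 1" "Suc j"] d(9)[OF h] d(7)[OF h]
      dom[of "p + l + 2"] d(5)[OF h] h by auto
  show "blk (blocked (Suc j) \<sigma> (p + l + 3)) (p + l + 2) \<le> Jseq l" if h: "p + l + 3 \<le> n"
  proof -
    have "best (Suc j) \<sigma> (p + l + 3) = r" if pr: "prv (\<sigma> (p + l + 3)) = Some (p + l + 2, r)" for r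
    proof -
      have in3: "p + l + 3 \<in> {1..n}" using h by auto
      \<comment> \<open>Agent \<open>p + l + 3\<close> need not hold the arm in general, but it does
        if it was just recommended.\<close>
      have "r \<in> active (\<sigma> (p + l + 3))" using wf in3 pr unfolding wf_state_def by blast
      then show ?thesis using d(11)[OF h pr] dom[of "p + l + 3"] h by auto
    qed
    then have "blk (blocked (Suc j) \<sigma> (p + l + 3)) (p + l + 2) = blk (\<sigma> (p + l + 3)) (p + l + 2)"
      by (rule blk_blocked_unchanged)
    then show ?thesis using d(10)[OF h] by simp
  qed
qed

lemma shielded_step:
  assumes sh: "shielded l j \<sigma>" and wf: "wf_state j \<sigma>" and l: "2 \<le> l" "l < p"
    and j: "Jseq (l - 1) \<le> j" "Suc j < Jseq l" and succ: "succ (Suc j) \<sigma> \<sigma>'"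
  shows "shielded l (Suc j) \<sigma>'"
proof (rule shielded_intro[OF wf l _ j(2) _ _ _ _ _ _ _ _ succ])
  show "Jseq l \<le> blk (blocked (Suc j) \<sigma> (p + l + 1)) (p + l)"
    using shieldedD(3)[OF sh] blk_blocked_ge[of \<sigma> "p + l + 1" "p + l" "Suc j"] by linarith
qed (use j shieldedD[OF sh] shielded_blocked[OF sh wf l j(1)] in auto)

text \<open>In phase \<open>Jseq l + 2\<close> agent \<open>p + l + 2\<close> plays the released arm
  most and hence blocks \<open>p + l + 1\<close>, which recommended another one. The block ends at
  \<open>(Jseq l + 2)\<^sup>2\<close>, which is exactly the next release phase.\<close>

lemma passed_shielded:
  assumes ps: "passed l \<sigma>" and wf: "wf_state (Suc (Jseq l)) \<sigma>" and l: "1 \<le> l" "l + 2 \<le> p"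
    and succ: "succ (Suc (Suc (Jseq l))) \<sigma> \<sigma>'"
  shows "shielded (Suc l) (Suc (Suc (Jseq l))) \<sigma>'"
proof -
  have e: "p + l + 1 + 1 = p + Suc l + 1" "p + l + 1 + 2 = p + Suc l + 2" "p + 1 - l = p + 2 - Suc l"
    "p + l + 1 = p + Suc l"
    by auto
  have ps': "\<And>i. i \<in> {p + Suc l + 1..n} \<Longrightarrow> active (\<sigma> i) \<subseteq> {p + 2 - Suc l..}"
    "\<And>i. i \<in> {p + Suc l + 2..n} \<Longrightarrow> malsafe (Suc (Jseq l)) \<sigma> i"
    "p + 2 - Suc l \<in> active (\<sigma> (p + Suc l + 1))"
    "\<exists>r. prv (\<sigma> (p + Suc l + 1)) = Some (p + Suc l, r) \<and> r \<noteq> p + 2 - Suc l"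
    "p + Suc l + 2 \<le> n \<Longrightarrow> p + 2 - Suc l \<in> active (\<sigma> (p + Suc l + 2))"
    "p + Suc l + 2 \<le> n \<Longrightarrow> prv (\<sigma> (p + Suc l + 2)) = Some (p + Suc l + 1, p + 2 - Suc l)"
    using ps unfolding passed_def Let_def e by blast+
  have ln: "p + Suc l + 1 \<le> n" using l n_eq by simp
  have dom: "best (Suc (Suc (Jseq l))) \<sigma> i = p + 2 - Suc l"
    if i: "i \<in> {p + Suc l + 1..n}" "p + 2 - Suc l \<in> active (\<sigma> i)" for i
  proof -
    have i1: "i \<in> {1..n}" using i by auto
    show ?thesis
      by (rule stage_dominant(1)[OF wf i1, of l, unfolded e(3)]) (use l ps'(1) i in auto)
  qed
  have J: "Jseq (Suc l) = (Suc (Suc (Jseq l)))\<^sup>2" using l by (simp add: Jseq_Suc)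
  have b: "blk (\<sigma> i) h \<le> (Suc (Jseq l))\<^sup>2" if "i \<in> {1..n}" for i h
    using wf that unfolding wf_state_def by blast
  \<comment> \<open>All earlier blocks were set by phase \<open>Jseq l + 1\<close> and therefore end
    strictly before the next release.\<close>
  have less: "(Suc (Jseq l))\<^sup>2 < Jseq (Suc l)" unfolding J by (rule power_strict_mono) auto
  obtain r where r: "prv (\<sigma> (p + Suc l + 1)) = Some (p + Suc l, r)" "r \<noteq> p + 2 - Suc l"
    using ps'(4) by blast
  show ?thesis
  proof (rule shielded_intro[OF wf _ _ _ _ ps'(1,2) _ ps'(3,5) _ _ _ succ])
    show "Jseq (Suc l) \<le> blk (blocked (Suc (Suc (Jseq l))) \<sigma> (p + Suc l + 1)) (p + Suc l)"
      unfolding J by (rule blk_blocked_block[of \<sigma> "p + Suc l + 1" "p + Suc l" r, OF r(1)]) (use dom ps'(3) ln r(2) in auto)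
    show "blk (blocked (Suc (Suc (Jseq l))) \<sigma> (p + Suc l + 1)) (p + Suc l + 2) < Jseq (Suc l)"
      using blk_blocked_unchanged[of \<sigma> "p + Suc l + 1" "p + Suc l + 2" "Suc (Suc (Jseq l))"] r(1)
        b[of "p + Suc l + 1" "p + Suc l + 2"] ln less by simp
    show "blk (blocked (Suc (Suc (Jseq l))) \<sigma> (p + Suc l + 2)) (p + Suc l + 1) < Jseq (Suc l)"
      if h: "p + Suc l + 2 \<le> n"
      using blk_blocked_unchanged[of \<sigma> "p + Suc l + 2" "p + Suc l + 1" "Suc (Suc (Jseq l))"]
        ps'(6)[OF h] dom[of "p + Suc l + 2"] ps'(5)[OF h] b[of "p + Suc l + 2" "p + Suc l + 1"] h less
      by simp
    \<comment> \<open>The previous draw of this agent was not prescribed, so it may block its left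
      neighbour now, up to \<open>Jseq (Suc l)\<close> inclusive. That is harmless, as its
      prescribed draw comes one phase later.\<close>
    show "blk (blocked (Suc (Suc (Jseq l))) \<sigma> (p + Suc l + 3)) (p + Suc l + 2) \<le> Jseq (Suc l)"
      if h: "p + Suc l + 3 \<le> n"
    proof (rule blk_blocked_le)
      show "blk (\<sigma> (p + Suc l + 3)) (p + Suc l + 2) \<le> Jseq (Suc l)"
        using b[of "p + Suc l + 3" "p + Suc l + 2"] h less by simp
    qed (simp add: J)
    show "Suc (Suc (Jseq l)) < Jseq (Suc l)" unfolding J by (simp add: power2_eq_square)
  qed (use l in auto)
qed

lemma shielded_cands:
  assumes sh: "shielded l j \<sigma>" and wf: "wf_state j \<sigma>" and l: "2 \<le> l" "l + 2 \<le> p"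
    and j: "Jseq (l - 1) \<le> j" "Suc j = Jseq l"
  shows "p + l + 2 \<in> cands (Suc j) \<sigma> (p + l + 1)" "n + 1 \<in> cands (Suc j) \<sigma> (p + l + 2)"
proof -
  have ln: "p + l + 2 \<le> n" using l n_eq by simp
  have lp: "l < p" using l by simp
  show "p + l + 2 \<in> cands (Suc j) \<sigma> (p + l + 1)"
    using shielded_blocked(1)[OF sh wf l(1) lp j(1) ln] nbrs_mem(3)[of "p + l + 1" n] ln j
    by (simp add: cands_def)
  show "n + 1 \<in> cands (Suc j) \<sigma> (p + l + 2)"
    using malsafe_cands[OF shieldedD(2)[OF sh]] ln by simp
qed

text \<open>Beyond \<open>arm_step\<close>, agent \<open>p + l + 3\<close> must not block
  \<open>p + l + 2\<close> in the next phase. If it hears from that agent in phase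
  \<open>Jseq l\<close>, it receives arm \<open>p + 2 - l\<close>, the best arm within its reach,
  and will play it most.\<close>

lemma shielded_armed:
  assumes sh: "shielded l j \<sigma>" and wf: "wf_state j \<sigma>" and l: "2 \<le> l" "l + 2 \<le> p"
    and j: "Jseq (l - 1) \<le> j" "Suc j = Jseq l" and succ: "succ (Suc j) \<sigma> \<sigma>'"
    and wf': "wf_state (Suc j) \<sigma>'"
    and f: "\<sigma>' (p + l + 1) = nxt (Suc j) \<sigma> (p + l + 1) (Some (p + l + 2))"
      "\<sigma>' (p + l + 2) = nxt (Suc j) \<sigma> (p + l + 2) (Some (n + 1))"
  shows "armed l \<sigma>'"
proof -
  have ln: "p + l + 2 \<le> n" using l n_eq by simp
  have lp: "l < p" and l1: "1 \<le> l" using l by simp_all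
  note d = shieldedD[OF sh] and bb = shielded_blocked[OF sh wf l(1) lp j(1)]
  show ?thesis
  proof (rule arm_step[OF l1 l(2) j(2) d(1,2) succ f])
    show "blk (\<sigma>' (p + l + 2)) (p + l + 1) \<le> Jseq l"
      using succ_blk[OF succ, of "p + l + 2"] bb(2)[OF ln] ln by simp
    assume h: "p + l + 3 \<le> n"
    have in3: "p + l + 3 \<in> {1..n}" using h by auto
    have "r = best (Suc (Jseq l)) \<sigma>' (p + l + 3)" if pr: "prv (\<sigma>' (p + l + 3)) = Some (p + l + 2, r)" for r
    proof -
      have r: "r = p + 2 - l"
        using succ_prv(2)[OF succ in3 pr] bb(4)[of "p + l + 2"] d(5)[OF ln] ln by (simp add: recm_def)
      have "r \<in> active (\<sigma>' (p + l + 3))" using wf' in3 pr unfolding wf_state_def by blast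
      moreover have "active (\<sigma>' (p + l + 3)) \<subseteq> {p + 2 - l..}"
        by (rule active_step[OF succ, of "p + l + 1"]) (use d(1) h unscheduled_right[OF j(2)] in auto)
      moreover have el: "p + 1 - (l - 1) = p + 2 - l" using l by auto
      moreover have "Jseq (l - 1) \<le> Suc (Jseq l)" using j by simp
      ultimately show ?thesis
        using stage_dominant(1)[OF wf' in3, of "l - 1" "Suc (Jseq l)"] l r by simp
    qed
    then show "blk (\<sigma>' (p + l + 3)) (p + l + 2) \<le> Jseq l \<and>
        (\<forall>r. prv (\<sigma>' (p + l + 3)) = Some (p + l + 2, r) \<longrightarrow> r = best (Suc (Jseq l)) \<sigma>' (p + l + 3))"
      using succ_blk[OF succ in3] bb(3)[OF h] by simp
  qed
qed


section \<open>Probabilities of the stages\<close>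

lemma prob_armed_one:
  assumes p: "3 \<le> p"
  shows "measure_pmf.prob (sys (Jseq 1)) {\<sigma>. armed 1 \<sigma>} \<ge> (1/27) ^ 256"
proof -
  let ?D = "{p + 2, p + 3, p + 4} \<inter> {..n}"
  let ?f = "\<lambda>i. if i = p + 2 then p + 3 else n + 1"
  have n6: "p + 3 \<le> n" using p n_eq by simp
  have b: "measure_pmf.prob (sys 255) {\<sigma>. base 255 \<sigma>} \<ge> (1/27) ^ 255" by (rule prob_base) simp
  have "measure_pmf.prob (sys (Suc 255)) {\<sigma>. armed 1 \<sigma>} \<ge> (1/27) ^ 255 * (1/3) ^ 3"
  proof (rule sys_step[OF b, where D = ?D and f = ?f])
    have "card ?D \<le> card {p + 2, p + 3, p + 4}" by (rule card_mono) auto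
    then show "card ?D \<le> 3" by simp
    show "?f i \<in> cands (Suc 255) \<sigma> i" if b: "base 255 \<sigma>" and i: "i \<in> ?D" for \<sigma> i
    proof (cases "i = p + 2")
      case True
      have "best 256 \<sigma> i = r" if "prv (\<sigma> i) = Some (p + 3, r)" for r
      proof -
        have "i \<in> {p + 2..n}" "i \<le> p + 4" using True n6 by auto
        then have "p + 3 = n + 1" using b that unfolding base_def by blast
        then show ?thesis using n6 by simp
      qed
      then have "blk (blocked 256 \<sigma> i) (p + 3) = blk (\<sigma> i) (p + 3)" by (rule blk_blocked_unchanged)
      then have "blk (blocked 256 \<sigma> i) (p + 3) = 0" using b True n6 by (auto simp: base_def)
      moreover have "p + 3 \<in> nbrs n i"
        using nbrs_mem(3)[of "p + 2" n] n6 True by (simp add: numeral_3_eq_3)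
      ultimately show ?thesis using True by (simp add: cands_def)
    next
      case False
      then have "n + 1 \<in> cands (Suc 255) \<sigma> i"
        using b i by (intro malsafe_cands) (auto simp: base_def)
      then show ?thesis using False by simp
    qed
    show "armed 1 \<sigma>'"
      if b: "base 255 \<sigma>" and succ: "succ (Suc 255) \<sigma> \<sigma>'"
        and f: "\<And>i. i \<in> ?D \<Longrightarrow> \<sigma>' i = nxt (Suc 255) \<sigma> i (Some (?f i))" for \<sigma> \<sigma>'
      by (rule base_armed[OF p b]) (use succ f[of "p + 2"] f[of "p + 3"] f[of "p + 4"] n6 in auto)
  qed auto
  moreover have "(1/27::real) ^ Suc 255 = (1/27) ^ 255 * (1/3) ^ 3"
    unfolding power_Suc2 by (simp only: power_divide power_one) simp
  moreover have "Suc 255 = 256" "Jseq 1 = 256" by simp_all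
  ultimately show ?thesis by (simp only:)
qed

lemma prob_passed:
  assumes l: "1 \<le> l" "l + 2 \<le> p" and c: "0 \<le> c" "measure_pmf.prob (sys (Jseq l)) {\<sigma>. armed l \<sigma>} \<ge> c"
  shows "measure_pmf.prob (sys (Suc (Jseq l))) {\<sigma>. passed l \<sigma>} \<ge> c / 9"
proof -
  let ?D = "{p + l + 2, p + l + 3} \<inter> {..n}"
  let ?f = "\<lambda>i. i - 1"
  have ln: "p + l + 2 \<le> n" using l n_eq by simp
  have m: "p + l + 2 - 1 = p + l + 1" "p + l + 3 - 1 = p + l + 2" by auto
  have "measure_pmf.prob (sys (Suc (Jseq l))) {\<sigma>. passed l \<sigma>} \<ge> c * (1/3) ^ 2"
  proof (rule sys_step[OF c(2), where D = ?D and f = ?f])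
    have "card ?D \<le> card {p + l + 2, p + l + 3}" by (rule card_mono) auto
    then show "card ?D \<le> 2" by simp
    show "i - 1 \<in> cands (Suc (Jseq l)) \<sigma> i" if "armed l \<sigma>" and i: "i \<in> ?D" for \<sigma> i
      using armed_cands[OF that(1) l] i m by auto
    show "passed l \<sigma>'"
      if "wf_state (Jseq l) \<sigma>" "armed l \<sigma>" "succ (Suc (Jseq l)) \<sigma> \<sigma>'"
        and f: "\<And>i. i \<in> ?D \<Longrightarrow> \<sigma>' i = nxt (Suc (Jseq l)) \<sigma> i (Some (i - 1))" for \<sigma> \<sigma>'
      by (rule armed_passed[OF that(2,1) l that(3)])
        (use f[of "p + l + 2", unfolded m] f[of "p + l + 3", unfolded m] ln in auto)
  qed (use c in auto)
  then show ?thesis by (simp add: power_divide)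
qed

text \<open>No draw is prescribed here: the shield persists under all outcomes, so the long wait
  until the next release costs no probability.\<close>

lemma prob_shielded:
  assumes l: "1 \<le> l" "l + 2 \<le> p"
    and c: "0 \<le> c" "measure_pmf.prob (sys (Suc (Jseq l))) {\<sigma>. passed l \<sigma>} \<ge> c"
    and j: "Suc (Suc (Jseq l)) \<le> j" "j < Jseq (Suc l)"
  shows "measure_pmf.prob (sys j) {\<sigma>. shielded (Suc l) j \<sigma>} \<ge> c"
  using j
proof (induction j rule: dec_induct)
  case base
  have "measure_pmf.prob (sys (Suc (Suc (Jseq l)))) {\<sigma>. shielded (Suc l) (Suc (Suc (Jseq l))) \<sigma>} \<ge> c * (1/3) ^ 0"
    by (rule sys_step[OF c(2), where D = "{}"]) (use passed_shielded[OF _ _ l] c in auto)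
  then show ?case by simp
next
  case (step j)
  then have IH: "measure_pmf.prob (sys j) {\<sigma>. shielded (Suc l) j \<sigma>} \<ge> c" by simp
  have "measure_pmf.prob (sys (Suc j)) {\<sigma>. shielded (Suc l) (Suc j) \<sigma>} \<ge> c * (1/3) ^ 0"
  proof (rule sys_step[OF IH, where D = "{}"])
    fix \<sigma> \<sigma>' assume "wf_state j \<sigma>" "shielded (Suc l) j \<sigma>" "succ (Suc j) \<sigma> \<sigma>'"
    then show "shielded (Suc l) (Suc j) \<sigma>'"
      using shielded_step[of "Suc l" j \<sigma> \<sigma>'] l step.hyps step.prems by auto
  qed (use c in auto)
  then show ?case by simp
qed

lemma prob_armed_Suc:
  assumes l: "1 \<le> l" "Suc l + 2 \<le> p"
    and c: "0 \<le> c" "measure_pmf.prob (sys (Suc (Jseq l))) {\<sigma>. passed l \<sigma>} \<ge> c"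
  shows "measure_pmf.prob (sys (Jseq (Suc l))) {\<sigma>. armed (Suc l) \<sigma>} \<ge> c / 9"
proof -
  define j where "j = Jseq (Suc l) - 1"
  have J: "Jseq (Suc l) = (Jseq l + 2)\<^sup>2" using l by (simp add: Jseq_Suc)
  have j: "Suc j = Jseq (Suc l)" "Suc (Suc (Jseq l)) \<le> j"
    by (auto simp: j_def J power2_eq_square)
  have l2: "2 \<le> Suc l" using l by simp
  have Jj: "Jseq (Suc l - 1) \<le> j" using j by simp
  have sh: "measure_pmf.prob (sys j) {\<sigma>. shielded (Suc l) j \<sigma>} \<ge> c"
    by (rule prob_shielded[OF _ _ c]) (use l j in auto)
  let ?D = "{p + Suc l + 1, p + Suc l + 2}"
  let ?f = "\<lambda>i. if i = p + Suc l + 1 then p + Suc l + 2 else n + 1"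
  have "measure_pmf.prob (sys (Suc j)) {\<sigma>. armed (Suc l) \<sigma>} \<ge> c * (1/3) ^ 2"
  proof (rule sys_step[OF sh, where D = ?D and f = ?f])
    show "?D \<subseteq> {1..n}" using l n_eq by auto
    show "?f i \<in> cands (Suc j) \<sigma> i" if "wf_state j \<sigma>" "shielded (Suc l) j \<sigma>" "i \<in> ?D" for \<sigma> i
      using shielded_cands[OF that(2,1) l2 l(2) Jj j(1)] that(3) by auto
    show "armed (Suc l) \<sigma>'"
      if "wf_state j \<sigma>" "wf_state (Suc j) \<sigma>'" "shielded (Suc l) j \<sigma>" "succ (Suc j) \<sigma> \<sigma>'"
        and f: "\<And>i. i \<in> ?D \<Longrightarrow> \<sigma>' i = nxt (Suc j) \<sigma> i (Some (?f i))" for \<sigma> \<sigma>'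
      by (rule shielded_armed[OF that(3,1) l2 l(2) Jj j(1) that(4,2)])
        (use f[of "p + Suc l + 1"] f[of "p + Suc l + 2"] in auto)
  qed (use c in auto)
  then show ?thesis by (simp add: j power_divide)
qed

text \<open>Each stage costs 1/9 to pass from \<open>armed\<close> to \<open>passed\<close> and
  another 1/9 to arm the next stage.\<close>

lemma prob_armed:
  assumes "1 \<le> l" "l + 2 \<le> p"
  shows "measure_pmf.prob (sys (Jseq l)) {\<sigma>. armed l \<sigma>} \<ge> (1/27) ^ 256 * (1/81) ^ (l - 1)"
  using assms
proof (induction l rule: nat_induct_at_least)
  case base
  then show ?case using prob_armed_one by simp
next
  case (Suc l)
  have "(1/27) ^ 256 * (1/81) ^ (l - 1) / 9 \<le> measure_pmf.prob (sys (Suc (Jseq l))) {\<sigma>. passed l \<sigma>}"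
    by (rule prob_passed) (use Suc in auto)
  from prob_armed_Suc[OF _ _ _ this] Suc
  have "(1/27) ^ 256 * (1/81) ^ (l - 1) / 9 / 9 \<le> measure_pmf.prob (sys (Jseq (Suc l))) {\<sigma>. armed (Suc l) \<sigma>}"
    by simp
  moreover have "(1/27::real) ^ 256 * (1/81) ^ (Suc l - 1) = (1/27) ^ 256 * (1/81) ^ (l - 1) / 9 / 9"
    using Suc.hyps by (cases l) auto
  ultimately show ?case by (simp only:)
qed

lemma prob_mono_imp:
  assumes "measure_pmf.prob M {x. P x} \<ge> c" "c' \<le> c" "\<And>x. P x \<Longrightarrow> Q x"
  shows "measure_pmf.prob M {x. Q x} \<ge> c'"
proof -
  have "measure_pmf.prob M {x. P x} \<le> measure_pmf.prob M {x. Q x}"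
    using assms(3) by (intro measure_pmf.finite_measure_mono) auto
  then show ?thesis using assms by linarith
qed

text \<open>In each of the stage events agent \<open>n\<close> is confined to arms above 1. The
  bound is for each phase separately, which is enough because regret is a sum over times.\<close>

lemma prob_no_optimal_arm:
  assumes "1 \<le> l" "l < p" "j < Jseq l"
  shows "measure_pmf.prob (sys j) {\<sigma>. 1 \<notin> active (\<sigma> n)} \<ge> (1/27) ^ 256 * (1/81) ^ (l - 1)"
  using assms
proof (induction l rule: nat_induct_at_least)
  case base
  then have j: "j < 256" by simp
  show ?case
  proof (rule prob_mono_imp[OF prob_base[OF j]])
    have "(1/27::real) ^ 256 \<le> (1/27) ^ j" using j by (intro power_decreasing) auto
    then show "(1/27::real) ^ 256 * (1/81) ^ (1 - 1) \<le> (1/27) ^ j" by simp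
    show "1 \<notin> active (\<sigma> n)" if "base j \<sigma>" for \<sigma>
    proof -
      have "n \<in> {p + 2..n}" using n_eq p_ge by auto
      then have "active (\<sigma> n) \<subseteq> {p + 1..}" using that unfolding base_def by blast
      then show ?thesis using p_ge by auto
    qed
  qed
next
  case (Suc l)
  let ?c = "(1/27) ^ 256 * (1/81) ^ (l - 1) :: real"
  have c0: "0 \<le> ?c" by simp
  have l: "1 \<le> l" "l + 2 \<le> p" using Suc by auto
  have c': "(1/27) ^ 256 * (1/81) ^ (Suc l - 1) = ?c / 81"
    using Suc.hyps by (cases l) auto
  have le: "?c / 81 \<le> ?c" "?c / 81 \<le> ?c / 9" using c0 by linarith+
  note armed = prob_armed[OF l] note passed = prob_passed[OF l c0 armed]
  have nn: "n \<in> {p + l + 2..n}" using l n_eq by simp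
  have arm: "1 \<notin> active (\<sigma> n)" if "active (\<sigma> n) \<subseteq> {p + 1 - l..}" for \<sigma> :: "nat \<Rightarrow> agst"
    using that l by auto
  \<comment> \<open>Earlier phases are left to the induction hypothesis; the other cases use
    \<open>armed\<close>, \<open>passed\<close> and \<open>shielded\<close> in turn.\<close>
  consider "j < Jseq l" | "j = Jseq l" | "j = Suc (Jseq l)" | "Suc (Suc (Jseq l)) \<le> j" by linarith
  then show ?case
  proof cases
    case 1
    then show ?thesis unfolding c' using Suc by (intro prob_mono_imp[OF Suc.IH le(1)]) auto
  next
    case 2
    show ?thesis unfolding c' 2
      by (rule prob_mono_imp[OF armed le(1)]) (use nn arm in \<open>auto simp: armed_def Let_def\<close>)
  next
    case 3
    show ?thesis unfolding c' 3
      by (rule prob_mono_imp[OF passed le(2)]) (use nn arm in \<open>auto simp: passed_def Let_def\<close>)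
  next
    case 4
    have "measure_pmf.prob (sys j) {\<sigma>. shielded (Suc l) j \<sigma>} \<ge> ?c / 9"
      by (rule prob_shielded[OF l _ passed 4]) (use Suc in auto)
    then show ?thesis unfolding c'
      by (rule prob_mono_imp[OF _ le(2)]) (use nn arm in \<open>auto simp: shielded_def Let_def\<close>)
  qed
qed

end

section \<open>Regret lower bounds\<close>

lemma mu_nonneg: "0 \<le> mu n k"
  by (auto simp: mu_def intro!: add_nonneg_nonneg sum_nonneg)

lemma phase_of_eq:
  assumes "j\<^sup>2 < t" "t \<le> (Suc j)\<^sup>2"
  shows "phase_of t = Suc j"
  unfolding phase_of_def
proof (rule Least_equality)
  fix y assume "t \<le> y\<^sup>2"
  then have "j\<^sup>2 < y\<^sup>2" using assms by simp
  then show "Suc j \<le> y" by (simp add: power2_less_imp_less Suc_le_eq)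
qed (rule assms)

lemma phase_of_le: "t \<le> j\<^sup>2 \<Longrightarrow> phase_of t \<le> j"
  unfolding phase_of_def by (rule Least_le)

lemma phase_of_bounds:
  assumes "1 \<le> t"
  obtains j where "phase_of t = Suc j" "j\<^sup>2 < t" "t \<le> (Suc j)\<^sup>2"
proof -
  have "t \<le> t\<^sup>2" by (cases t) (auto simp: power2_eq_square)
  then have le: "t \<le> (phase_of t)\<^sup>2" unfolding phase_of_def by (rule LeastI)
  then have "phase_of t \<noteq> 0" using assms by (intro notI) simp
  then obtain j where j: "phase_of t = Suc j" using not0_implies_Suc by blast
  have "\<not> t \<le> j\<^sup>2" using phase_of_le[of t j] j by auto
  then show ?thesis using that[OF j] le j by simp
qed

context line_instance
begin

abbreviation reg :: "nat \<Rightarrow> real" where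
  "reg T \<equiv> regret n tbI tbB tbU s u0 l0 n T"

definition step_regret :: "nat \<Rightarrow> real" where
  "step_regret t = measure_pmf.expectation (sys (phase_of t - 1)) (\<lambda>\<sigma>. mu n 1 - mu n (pulled n tbI n t \<sigma>))"

lemma reg_eq: "reg T = (\<Sum>t=1..T. step_regret t)"
  by (simp add: regret_def step_regret_def)

lemma gap_bounds: "0 \<le> mu n 1 - mu n k" "mu n 1 - mu n k \<le> 1"
  using mu_le_1[of n k] mu_nonneg[of n k] by simp_all

lemma step_regret_nonneg: "0 \<le> step_regret t"
  unfolding step_regret_def using gap_bounds by (intro Bochner_Integration.integral_nonneg) auto

lemma reg_mono: "T \<le> T' \<Longrightarrow> reg T \<le> reg T'"
  unfolding reg_eq by (rule sum_mono2) (auto simp: step_regret_nonneg)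

lemma n_in: "n \<in> {1..n}" "n \<in> {p + 1..n}"
  using n_eq p_ge by auto

lemma pulled_active: "pulled n tbI n t \<sigma> \<in> active (\<sigma> n)"
  using pick_active[OF tieI] by (simp add: pulled_def Let_def) (metis active_upto)

text \<open>Times up to \<open>(Jseq l)\<^sup>2\<close> belong to phases up to
  \<open>Jseq l\<close>, whose initial states are covered by \<open>prob_no_optimal_arm\<close>; any
  arm other than 1 costs at least 1/15.\<close>

lemma reg_ge_blocked:
  assumes l: "1 \<le> l" "l < p" and T: "T \<le> (Jseq l)\<^sup>2"
  shows "reg T \<ge> (1/27) ^ 256 * (1/81) ^ (l - 1) / 15 * real T"
proof -
  have "step_regret t \<ge> (1/27) ^ 256 * (1/81) ^ (l - 1) * (1/15)" if t: "t \<in> {1..T}" for t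
  proof -
    have t1: "1 \<le> t" using t by simp
    obtain j where j: "phase_of t = Suc j" "j\<^sup>2 < t" using phase_of_bounds[OF t1] by blast
    have "phase_of t \<le> Jseq l" by (rule phase_of_le) (use t T in auto)
    then have jl: "phase_of t - 1 < Jseq l" using j by simp
    show ?thesis unfolding step_regret_def
    proof (rule expectation_ge[OF prob_no_optimal_arm[OF l jl]])
      fix \<sigma> assume "1 \<notin> active (\<sigma> n)"
      then have "pulled n tbI n t \<sigma> \<noteq> 1" using pulled_active[of t \<sigma>] by metis
      then have "mu n (pulled n tbI n t \<sigma>) \<le> 14/15" by (rule mu_suboptimal)
      then show "1/15 \<le> mu n 1 - mu n (pulled n tbI n t \<sigma>)" by simp
    qed (use gap_bounds in auto)
  qed
  then have "real (card {1..T}) * ((1/27) ^ 256 * (1/81) ^ (l - 1) * (1/15)) \<le> (\<Sum>t=1..T. step_regret t)"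
    by (intro sum_bounded_below)
  then show ?thesis by (simp add: reg_eq algebra_simps)
qed

lemma s_zero: "mu n (s n) = 0"
  using init_right[OF n_in(2)] n_eq p_ge by (simp add: mu_def)

lemma reg_ge_1: "1 \<le> T \<Longrightarrow> 1 \<le> reg T"
proof -
  assume T: "1 \<le> T"
  have ph: "phase_of (Suc 0) = Suc 0" by (rule phase_of_eq) auto
  have "mu n k = 0" if "k \<in> active (init_st s u0 l0 n)" for k
  proof -
    have "p < k" using that init_right[OF n_in(2)] by (auto simp: init_st_def active_def)
    then show ?thesis using n_eq p_ge by (simp add: mu_def)
  qed
  then have "step_regret 1 = 1"
    using pulled_active[of 1 "init_st s u0 l0"] by (simp add: step_regret_def ph)
  moreover have "step_regret 1 = reg 1" by (simp add: reg_eq)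
  ultimately show ?thesis using reg_mono[OF T] by simp
qed

section \<open>Sticky pulls and the logarithmic term\<close>

definition sticky_pulls :: "nat \<Rightarrow> real" where
  "sticky_pulls j = measure_pmf.expectation (sys j) (\<lambda>\<sigma>. real (cnt (\<sigma> n) (s n)))"

text \<open>The random draws at the end of a phase do not change counts, which are determined by the
  state at the start of the phase.\<close>

lemma sticky_pulls_Suc:
  "sticky_pulls (Suc j) = measure_pmf.expectation (sys j) (\<lambda>\<sigma>. real (cnt (finish (Suc j) \<sigma> n) (s n)))"
proof -
  have "map_pmf (\<lambda>\<sigma>. real (cnt (\<sigma> n) (s n))) (trans n tbI tbB tbU (Suc j) \<sigma>)
      = return_pmf (real (cnt (finish (Suc j) \<sigma> n) (s n)))" for \<sigma>
    using n_in(1) by (simp add: trans_eq pmf.map_comp o_def map_pmf_const)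
  then have "map_pmf (\<lambda>\<sigma>. real (cnt (\<sigma> n) (s n))) (sys (Suc j))
      = map_pmf (\<lambda>\<sigma>. real (cnt (finish (Suc j) \<sigma> n) (s n))) (sys j)"
    by (simp add: map_bind_pmf map_pmf_def[of _ "sys j"])
  then have "measure_pmf.expectation (map_pmf (\<lambda>\<sigma>. real (cnt (\<sigma> n) (s n))) (sys (Suc j))) (\<lambda>x. x)
      = measure_pmf.expectation (map_pmf (\<lambda>\<sigma>. real (cnt (finish (Suc j) \<sigma> n) (s n))) (sys j)) (\<lambda>x. x)"
    by (simp only:)
  then show ?thesis by (simp add: sticky_pulls_def)
qed

lemma integrable_sticky:
  "integrable (measure_pmf (sys j)) (\<lambda>\<sigma>. real (cnt (\<sigma> n) (s n)))"
  "integrable (measure_pmf (sys j)) (\<lambda>\<sigma>. real (cnt (finish (Suc j) \<sigma> n) (s n)))"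
proof -
  have c: "cnt (\<sigma> n) (s n) \<le> j\<^sup>2" if "\<sigma> \<in> set_pmf (sys j)" for \<sigma>
    using wf_sys[OF that] n_in(1) unfolding wf_state_def by blast
  have f: "cnt (finish (Suc j) \<sigma> n) (s n) \<le> cnt (\<sigma> n) (s n) + ((Suc j)\<^sup>2 - j\<^sup>2)" for \<sigma>
    unfolding finish_def run_phase_def diff_Suc_1 by (rule cnt_upto_le)
  show "integrable (measure_pmf (sys j)) (\<lambda>\<sigma>. real (cnt (\<sigma> n) (s n)))"
    by (rule measure_pmf.integrable_const_bound[where B = "real (j\<^sup>2)"])
      (use c in \<open>auto simp: AE_measure_pmf_iff simp del: of_nat_power\<close>)
  show "integrable (measure_pmf (sys j)) (\<lambda>\<sigma>. real (cnt (finish (Suc j) \<sigma> n) (s n)))"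
  proof (rule measure_pmf.integrable_const_bound[where B = "real ((Suc j)\<^sup>2)"])
    have "cnt (finish (Suc j) \<sigma> n) (s n) \<le> (Suc j)\<^sup>2" if "\<sigma> \<in> set_pmf (sys j)" for \<sigma>
      using c[OF that] f[of \<sigma>] power_mono[of j "Suc j" 2] by simp
    then show "AE \<sigma> in measure_pmf (sys j). norm (real (cnt (finish (Suc j) \<sigma> n) (s n))) \<le> real ((Suc j)\<^sup>2)"
      by (auto simp: AE_measure_pmf_iff simp del: of_nat_power)
  qed simp
qed

text \<open>Each pull of the sticky arm of agent \<open>n\<close> costs 1, since its mean is 0, and
  other pulls cost at least 0. The inequality holds on every path before expectations are
  taken.\<close>

lemma phase_regret:
  "(\<Sum>t=j\<^sup>2 + 1..(Suc j)\<^sup>2. step_regret t) \<ge> sticky_pulls (Suc j) - sticky_pulls j"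
proof -
  define m where "m = (Suc j)\<^sup>2 - j\<^sup>2"
  have jm: "(Suc j)\<^sup>2 = j\<^sup>2 + m" using power_mono[of j "Suc j" 2] by (simp add: m_def)
  let ?pk = "\<lambda>\<sigma> r. pick tbI (j\<^sup>2 + Suc r) (upto n tbI (\<sigma> n) (j\<^sup>2) r)"
  have st: "step_regret (j\<^sup>2 + Suc r) = measure_pmf.expectation (sys j) (\<lambda>\<sigma>. mu n 1 - mu n (?pk \<sigma> r))"
    if "r < m" for r
  proof -
    have "phase_of (j\<^sup>2 + Suc r) = Suc j" by (rule phase_of_eq) (use that jm in auto)
    then show ?thesis by (simp add: step_regret_def pulled_def)
  qed
  have int: "integrable (measure_pmf (sys j)) (\<lambda>\<sigma>. mu n 1 - mu n (?pk \<sigma> r))" for r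
    by (rule measure_pmf.integrable_const_bound[where B = 1]) (use gap_bounds in auto)
  have "(\<Sum>t=j\<^sup>2 + 1..(Suc j)\<^sup>2. step_regret t) = (\<Sum>r<m. step_regret (j\<^sup>2 + Suc r))"
    unfolding jm by (rule sum.reindex_bij_witness[where i = "\<lambda>r. j\<^sup>2 + Suc r" and j = "\<lambda>t. t - j\<^sup>2 - 1"]) auto
  also have "\<dots> = (\<Sum>r<m. measure_pmf.expectation (sys j) (\<lambda>\<sigma>. mu n 1 - mu n (?pk \<sigma> r)))"
    by (intro sum.cong refl st) simp
  also have "\<dots> = measure_pmf.expectation (sys j) (\<lambda>\<sigma>. \<Sum>r<m. mu n 1 - mu n (?pk \<sigma> r))"
    using int by (subst Bochner_Integration.integral_sum) auto
  also have "\<dots> \<ge> measure_pmf.expectation (sys j)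
      (\<lambda>\<sigma>. real (cnt (finish (Suc j) \<sigma> n) (s n)) - real (cnt (\<sigma> n) (s n)))"
  proof (rule integral_mono)
    fix \<sigma>
    have "finish (Suc j) \<sigma> n = upto n tbI (\<sigma> n) (j\<^sup>2) m"
      by (simp add: finish_def run_phase_def m_def)
    then have "real (cnt (finish (Suc j) \<sigma> n) (s n)) - real (cnt (\<sigma> n) (s n))
        = real (card {r. r < m \<and> ?pk \<sigma> r = s n})" by (simp add: cnt_upto_eq_card)
    also have "\<dots> = (\<Sum>r<m. if ?pk \<sigma> r = s n then 1 else 0)"
      by (simp add: sum.If_cases Int_def)
    also have "\<dots> \<le> (\<Sum>r<m. mu n 1 - mu n (?pk \<sigma> r))"
      using gap_bounds(1) s_zero by (intro sum_mono) auto
    finally show "real (cnt (finish (Suc j) \<sigma> n) (s n)) - real (cnt (\<sigma> n) (s n))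
        \<le> (\<Sum>r<m. mu n 1 - mu n (?pk \<sigma> r))" .
  qed (use int integrable_sticky in \<open>auto intro!: Bochner_Integration.integrable_sum Bochner_Integration.integrable_diff\<close>)
  also have "measure_pmf.expectation (sys j)
      (\<lambda>\<sigma>. real (cnt (finish (Suc j) \<sigma> n) (s n)) - real (cnt (\<sigma> n) (s n)))
      = sticky_pulls (Suc j) - sticky_pulls j"
    unfolding sticky_pulls_Suc sticky_pulls_def[of j]
    by (rule Bochner_Integration.integral_diff[OF integrable_sticky(2,1)])
  finally show ?thesis .
qed

lemma reg_ge_sticky: "reg (j\<^sup>2) \<ge> sticky_pulls j"
proof (induction j)
  case 0
  then show ?case by (simp add: sticky_pulls_def reg_eq init_st_def)
next
  case (Suc j)
  have le: "j\<^sup>2 \<le> (Suc j)\<^sup>2" by (rule power_mono) auto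
  have "reg ((Suc j)\<^sup>2) = reg (j\<^sup>2) + (\<Sum>t=j\<^sup>2 + 1..(Suc j)\<^sup>2. step_regret t)"
    unfolding reg_eq
    using sum.ub_add_nat[of 1 "j\<^sup>2" step_regret "(Suc j)\<^sup>2 - j\<^sup>2"] le
    by (simp only: le_add_diff_inverse le_add2)
  then show ?case using Suc phase_regret[of j] by simp
qed

lemma sticky_pulls_ge:
  assumes "3 \<le> j"
  shows "sticky_pulls j \<ge> ln (real j) / 4"
proof -
  obtain i where i: "j = Suc i" using assms by (cases j) auto
  have "measure_pmf.expectation (sys i) (\<lambda>_. ln (real j) / 4)
      \<le> measure_pmf.expectation (sys i) (\<lambda>\<sigma>. real (cnt (finish (Suc i) \<sigma> n) (s n)))"
  proof (rule integral_mono_AE)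
    show "AE \<sigma> in measure_pmf (sys i). ln (real j) / 4 \<le> real (cnt (finish (Suc i) \<sigma> n) (s n))"
      unfolding AE_measure_pmf_iff
    proof
      fix \<sigma> assume "\<sigma> \<in> set_pmf (sys i)"
      then have w: "rewards_consistent n (\<sigma> n)" "stk (\<sigma> n) = s n"
        using wf_sys n_in(1) unfolding wf_state_def by blast+
      show "ln (real j) / 4 \<le> real (cnt (finish (Suc i) \<sigma> n) (s n))"
        using sticky_count_lower[OF tieI w(1) mu_le_1, of j] w(2) s_zero assms
        by (simp add: finish_def i)
    qed
  qed (use integrable_sticky in auto)
  then show ?thesis by (simp add: i sticky_pulls_Suc)
qed

text \<open>With \<open>j\<close> completed phases before \<open>T\<close> and
  \<open>j \<ge> 3\<close>, \<open>T\<close> is at most \<open>j ^ 4\<close>, so \<open>ln j\<close>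
  loses only a factor 4. For smaller \<open>j\<close> the horizon is at most 9 and the first pull
  alone suffices.\<close>

lemma reg_ge_ln:
  assumes "1 \<le> T"
  shows "reg T \<ge> ln (real T) / 16"
proof -
  obtain j where j: "j\<^sup>2 < T" "T \<le> (Suc j)\<^sup>2" using phase_of_bounds[OF assms] by blast
  show ?thesis
  proof (cases "3 \<le> j")
    case True
    have "Suc j \<le> j\<^sup>2" using True by (cases j) (auto simp: power2_eq_square)
    then have "(Suc j)\<^sup>2 \<le> (j\<^sup>2)\<^sup>2" by (rule power_mono) simp
    then have "T \<le> j ^ 4" using j by (simp add: power_mult[symmetric])
    then have "real T \<le> real j ^ 4" by (metis of_nat_le_iff of_nat_power)
    then have "ln (real T) \<le> ln (real j ^ 4)" using assms by (intro ln_mono) auto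
    then have "ln (real T) \<le> 4 * ln (real j)" using True by (simp add: ln_realpow)
    moreover have "reg T \<ge> ln (real j) / 4"
      using reg_mono[of "j\<^sup>2" T] reg_ge_sticky[of j] sticky_pulls_ge[OF True] j by linarith
    ultimately show ?thesis by simp
  next
    case False
    then have "(Suc j)\<^sup>2 \<le> 3\<^sup>2" by (intro power_mono) auto
    then have "T \<le> 9" using j by simp
    moreover have "ln (real T) \<le> real T - 1" using assms by (intro ln_le_minus_one) simp
    ultimately show ?thesis using reg_ge_1[OF assms] by linarith
  qed
qed

text \<open>After taking logarithms, \<open>exp (2/3) \<le> 2\<close> bounds the double exponential
  by \<open>2 ^ p\<close>, and \<open>81 ^ p\<close> contributes at most
  \<open>5 * p\<close>.\<close>

lemma exp_exp_le:
  "exp (exp (real n / 3)) * 81 ^ p \<le> exp 5 * 2 ^ 2 ^ (p + 2)"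
proof -
  have "exp (2/3) \<le> exp (ln (2::real))" using ln2_ge_two_thirds by (simp only: exp_le_cancel_iff)
  then have e2: "exp (2/3) \<le> (2::real)" by simp
  have "exp (real n / 3) = exp (2/3) ^ p" by (simp add: n_eq exp_of_nat_mult[symmetric] algebra_simps)
  also have "\<dots> \<le> 2 ^ p" using e2 by (intro power_mono) auto
  finally have 1: "exp (real n / 3) \<le> 2 ^ p" .
  have "ln (3::real) \<le> 5/4"
  proof -
    have "ln (3/2::real) \<le> 1/2" using ln_le_minus_one[of "3/2::real"] by simp
    moreover have "ln (3::real) = ln (3/2) + ln 2" by (simp add: ln_div)
    ultimately show ?thesis using ln2_le_25_over_36 by simp
  qed
  moreover have "ln (81::real) = 4 * ln 3" using ln_realpow[of "3::real" 4] by simp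
  ultimately have l81: "ln (81::real) \<le> 5" by simp
  \<comment> \<open>Scaled by 5/3 this gives \<open>5 * p \<le> 5/3 * 2 ^ p + 5\<close>; adding
    \<open>2 ^ p\<close> yields the \<open>8/3 * 2 ^ p\<close> available on the right and the
    constant 5.\<close>
  have "3 * m \<le> 2 ^ m + 3" for m :: nat
  proof (induction m)
    case (Suc m)
    show ?case
    proof (cases "m \<le> 1")
      case True
      then show ?thesis by (cases m) auto
    next
      case False
      then have "(2::nat) ^ 2 \<le> 2 ^ m" by (intro power_increasing) auto
      then show ?thesis using Suc by simp
    qed
  qed simp
  then have "real (3 * p) \<le> real (2 ^ p + 3)" by (simp only: of_nat_le_iff)
  then have 2: "3 * real p \<le> 2 ^ p + 3" by simp
  have "ln (2 ^ 2 ^ (p + 2) :: real) = 2 ^ (p + 2) * ln 2" by (simp add: ln_realpow)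
  also have "\<dots> \<ge> 2 ^ (p + 2) * (2/3)" using ln2_ge_two_thirds by (intro mult_left_mono) auto
  finally have 3: "ln (2 ^ 2 ^ (p + 2) :: real) \<ge> 8/3 * 2 ^ p" by simp
  have "real p * ln 81 \<le> real p * 5" using l81 by (intro mult_left_mono) auto
  then have "exp (real n / 3) + real p * ln 81 \<le> 5 + ln (2 ^ 2 ^ (p + 2) :: real)"
    using 1 2 3 by linarith
  then have "exp (exp (real n / 3) + real p * ln 81) \<le> exp (5 + ln (2 ^ 2 ^ (p + 2) :: real))"
    by simp
  moreover have "exp (real p * ln 81) = (81::real) ^ p" by (simp add: exp_of_nat_mult)
  ultimately show ?thesis by (simp add: exp_add)
qed

text \<open>For horizons within the cascade the first stage that covers \<open>T\<close> gives
  \<open>T / ln T ^ 7\<close>. For longer ones, the regret up to the last covered horizon gives the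
  double exponential, and the sticky arm gives \<open>ln T\<close>.\<close>

lemma regret_lower_bound:
  assumes T: "2 \<le> T"
  shows "reg T \<ge> (1/27) ^ 256 * exp (-5) / 3840
            * min (ln (real T) + exp (exp (real n / 3))) (real T / ln (real T) ^ 7)"
proof -
  define \<kappa> :: real where "\<kappa> = (1/27) ^ 256"
  have \<kappa>: "0 < \<kappa>" "\<kappa> \<le> 1" unfolding \<kappa>_def by (auto intro: power_le_one)
  have e5: "0 < exp (-5::real)" "exp (-5::real) \<le> 1" by auto
  define c where "c = \<kappa> * exp (-5) / 3840"
  have c0: "0 < c" using \<kappa> by (simp add: c_def)
  have \<kappa>e: "\<kappa> * exp (-5) \<le> \<kappa>" using \<kappa> e5 by (simp add: mult_left_le)
  have lnT: "ln (real T) \<ge> 1/2"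
  proof -
    have "ln 2 \<le> ln (real T)" using T by (intro ln_mono) auto
    then show ?thesis using ln2_ge_two_thirds by linarith
  qed
  have blocked: "reg T \<ge> \<kappa> * (1/81) ^ (l - 1) / 15 * real T"
    if "1 \<le> l" "l < p" "T \<le> (Jseq l)\<^sup>2" for l
    using reg_ge_blocked[OF that] by (simp only: \<kappa>_def)
  show ?thesis
  proof (cases "T \<le> (Jseq (p - 1))\<^sup>2")
    case True
    define l where "l = (LEAST l. 1 \<le> l \<and> T \<le> (Jseq l)\<^sup>2)"
    have pp: "1 \<le> p - 1 \<and> T \<le> (Jseq (p - 1))\<^sup>2" using True p_ge by simp
    have l: "1 \<le> l" "T \<le> (Jseq l)\<^sup>2" using LeastI[of "\<lambda>l. 1 \<le> l \<and> T \<le> (Jseq l)\<^sup>2", OF pp] by (auto simp: l_def)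
    have "l \<le> p - 1" unfolding l_def by (rule Least_le[of "\<lambda>l. 1 \<le> l \<and> T \<le> (Jseq l)\<^sup>2", OF pp])
    then have lp: "l < p" using p_ge by simp
    \<comment> \<open>Minimality of \<open>l\<close> puts \<open>T\<close> above
      \<open>(Jseq (l - 1))\<^sup>2\<close>, which is doubly exponential in \<open>l\<close>; for
      \<open>l = 1\<close> the claim is \<open>1/2 \<le> ln T\<close>.\<close>
    have "(1/2 * 2 ^ (l - 1)) \<le> ln (real T)"
    proof (cases "l = 1")
      case False
      then have l2: "1 \<le> l - 1" using l by simp
      have "l - 1 < (LEAST l. 1 \<le> l \<and> T \<le> (Jseq l)\<^sup>2)" unfolding l_def[symmetric] using l(1) by simp
      from not_less_Least[OF this] have "\<not> T \<le> (Jseq (l - 1))\<^sup>2" using l2 by simp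
      moreover have "(2::nat) ^ 2 ^ (l - 1) \<le> 2 ^ 2 ^ (l - 1 + 2)"
        by (intro power_increasing) auto
      moreover have "Jseq (l - 1) \<le> (Jseq (l - 1))\<^sup>2" by (simp add: power2_eq_square)
      ultimately have "2 ^ 2 ^ (l - 1) \<le> T" using Jseq_ge[OF l2] by linarith
      then have "(2::real) ^ 2 ^ (l - 1) \<le> real T" by (metis of_nat_le_iff of_nat_numeral of_nat_power)
      then have "ln ((2::real) ^ 2 ^ (l - 1)) \<le> ln (real T)" by (intro ln_mono) auto
      moreover have "ln ((2::real) ^ 2 ^ (l - 1)) = 2 ^ (l - 1) * ln 2" by (simp add: ln_realpow)
      moreover have "2 ^ (l - 1) * (1/2) \<le> 2 ^ (l - 1) * ln (2::real)"
        using ln2_ge_two_thirds by (intro mult_left_mono) auto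
      ultimately show ?thesis by linarith
    qed (use lnT in simp)
    then have "(1/2 * 2 ^ (l - 1)) ^ 7 \<le> ln (real T) ^ 7" by (intro power_mono) auto
    moreover have "(1/2 * 2 ^ (l - 1) :: real) ^ 7 = 128 ^ (l - 1) / 128"
    proof -
      have "((2::real) ^ (l - 1)) ^ 7 = (2 ^ 7) ^ (l - 1)"
        by (simp only: power_mult[symmetric] mult.commute)
      then show ?thesis by (simp add: power_mult_distrib power_divide)
    qed
    moreover have "(81::real) ^ (l - 1) \<le> 128 ^ (l - 1)" by (intro power_mono) auto
    ultimately have 7: "81 ^ (l - 1) / 128 \<le> ln (real T) ^ 7" by linarith
    have "c * (real T / ln (real T) ^ 7) \<le> c * (real T / (81 ^ (l - 1) / 128))"
      using c0 7 lnT by (intro mult_left_mono divide_left_mono mult_pos_pos zero_less_power) auto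
    also have "\<dots> = (\<kappa> * exp (-5) / 3840) * (128 * real T / 81 ^ (l - 1))"
      by (simp add: c_def)
    also have "\<dots> \<le> (\<kappa> / 3840) * (128 * real T / 81 ^ (l - 1))"
      using \<kappa>e by (intro mult_right_mono divide_right_mono) auto
    also have "\<dots> \<le> \<kappa> * (1/81) ^ (l - 1) / 15 * real T"
      using \<kappa> by (simp add: power_divide field_simps)
    also have "\<dots> \<le> reg T" by (rule blocked[OF l(1) lp l(2)])
    finally have "c * (real T / ln (real T) ^ 7) \<le> reg T" .
    moreover have "c * min (ln (real T) + exp (exp (real n / 3))) (real T / ln (real T) ^ 7)
        \<le> c * (real T / ln (real T) ^ 7)"
      using c0 by (intro mult_left_mono) auto
    ultimately show ?thesis by (simp add: c_def \<kappa>_def)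
  next
    case False
    have p1: "1 \<le> p - 1" "p - 1 < p" using p_ge by auto
    let ?J = "Jseq (p - 1)"
    have "reg T \<ge> reg (?J\<^sup>2)" using False by (intro reg_mono) simp
    moreover have "reg (?J\<^sup>2) \<ge> \<kappa> * (1/81) ^ (p - 1 - 1) / 15 * real (?J\<^sup>2)"
      using reg_ge_blocked[OF p1] by (simp only: \<kappa>_def)
    \<comment> \<open>The exponent \<open>p - 2\<close> is weakened to \<open>p\<close> to fit
      \<open>exp_exp_le\<close>.\<close>
    moreover have "\<kappa> * (1/81) ^ p / 15 * 2 ^ 2 ^ (p + 2) \<le> \<kappa> * (1/81) ^ (p - 1 - 1) / 15 * real (?J\<^sup>2)"
    proof (intro mult_mono divide_right_mono)
      have "p - 1 + 2 = p + 1" using p_ge by simp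
      then have "(2 ^ 2 ^ (p + 1))\<^sup>2 \<le> ?J\<^sup>2"
        using Jseq_ge[OF p1(1)] by (intro power_mono) auto
      then have "2 ^ 2 ^ (p + 2) \<le> ?J\<^sup>2" by (simp add: power_mult[symmetric] mult.commute)
      then show "(2::real) ^ 2 ^ (p + 2) \<le> real (?J\<^sup>2)"
        by (metis of_nat_le_iff of_nat_numeral of_nat_power)
      show "(1/81::real) ^ p \<le> (1/81) ^ (p - 1 - 1)" by (intro power_decreasing) auto
    qed (use \<kappa> in auto)
    moreover have "\<kappa> * exp (-5) / 15 * exp (exp (real n / 3)) \<le> \<kappa> * (1/81) ^ p / 15 * 2 ^ 2 ^ (p + 2)"
    proof -
      have "exp (-5) * exp (exp (real n / 3)) \<le> (1/81) ^ p * 2 ^ 2 ^ (p + 2)"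
        using exp_exp_le by (simp add: exp_minus power_divide field_simps)
      then have "\<kappa> / 15 * (exp (-5) * exp (exp (real n / 3))) \<le> \<kappa> / 15 * ((1/81) ^ p * 2 ^ 2 ^ (p + 2))"
        using \<kappa> by (intro mult_left_mono) auto
      then show ?thesis by (simp add: mult_ac)
    qed
    ultimately have r1: "reg T \<ge> \<kappa> * exp (-5) / 15 * exp (exp (real n / 3))" by linarith
    have r2: "reg T \<ge> ln (real T) / 16" using T by (intro reg_ge_ln) simp
    have "0 \<le> \<kappa> * exp (-5)" using \<kappa> by simp
    \<comment> \<open>Half of the regret pays for each summand: 1/32 is half of 1/16, and 1/30 is
      half of 1/15. The constant 3840 is 30 times 128, where 128 compensates for the seventh power
      of 1/2 in the other case.\<close>
    then have "c \<le> 1/32" "c \<le> \<kappa> * exp (-5) / 30" unfolding c_def using \<kappa>(2) \<kappa>e by linarith+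
    then have "c * ln (real T) \<le> 1/32 * ln (real T)"
      "c * exp (exp (real n / 3)) \<le> \<kappa> * exp (-5) / 30 * exp (exp (real n / 3))"
      using lnT by (intro mult_right_mono; simp)+
    moreover have "\<kappa> * exp (-5) / 30 * exp (exp (real n / 3)) = (\<kappa> * exp (-5) / 15 * exp (exp (real n / 3))) / 2"
      by simp
    ultimately have "c * ln (real T) + c * exp (exp (real n / 3)) \<le> reg T" using r1 r2 by linarith
    moreover have "c * min (ln (real T) + exp (exp (real n / 3))) (real T / ln (real T) ^ 7)
        \<le> c * (ln (real T) + exp (exp (real n / 3)))"
      using c0 by (intro mult_left_mono) auto
    ultimately have "c * min (ln (real T) + exp (exp (real n / 3))) (real T / ln (real T) ^ 7) \<le> reg T"
      by (simp add: distrib_left)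
    then show ?thesis by (simp only: c_def \<kappa>_def)
  qed
qed

end

theorem theorem1:
  shows "\<exists>c>0. \<forall>n T tbI tbB tbU (s::nat\<Rightarrow>nat) u0 l0.
     n \<ge> 4 \<and> even n \<and> T \<ge> 2
     \<and> tie_rule tbI \<and> tie_rule tbB \<and> tie_rule tbU
     \<and> (\<forall>i\<in>{1..n}. s i \<in> {1..n} \<and> u0 i \<in> {1..n} \<and> l0 i \<in> {1..n}
                   \<and> u0 i \<noteq> l0 i \<and> u0 i \<noteq> s i \<and> l0 i \<noteq> s i)
     \<and> (\<forall>i\<in>{n div 2 + 1..n}. Min {s i, u0 i, l0 i} > n div 2)
     \<longrightarrow> regret n tbI tbB tbU s u0 l0 n T
         \<ge> c * min (ln (real T) + exp (exp (real n / 3))) (real T / (ln (real T)) ^ 7)"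
proof (intro exI[of _ "(1/27) ^ 256 * exp (-5) / 3840 :: real"] conjI allI impI, goal_cases)
  case 1
  show ?case by simp
next
  case (2 n T tbI tbB tbU s u0 l0)
  interpret line_instance n "n div 2" tbI tbB tbU s u0 l0
    by unfold_locales (use 2 in auto)
  show ?case by (rule regret_lower_bound) (use 2 in simp)
qed

end
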